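(* The twist move is an unknotting operation for welded knots: every welded knot diagram can be transformed into the trivial diagram (a simple closed curve without crossings) by a finite sequence of twist moves and welded Reidemeister moves.
   Context: A welded knot diagram is a generic immersion of one circle in the plane in which every double point is marked either as a classical crossing (with over/under information) or as a welded crossing (no over/under information). Welded Reidemeister moves are: the classical Reidemeister moves RI, RII, RIII; the moves VRI, VRII, VRIII (the versions of RI, RII, RIII in which all crossings are welded); the move SV (the Reidemeister-III-type move in which an arc having two welded crossings is moved across a classical crossing); and the move $F_1$ (the Reidemeister-III-type move in which an arc passing over two strands at two classical crossings is moved across the welded crossing of these two strands). Two diagrams are equivalent if related by a finite sequence of welded Reidemeister moves (and planar isotopy); a welded knot is an equivalence class. Equivalently, a diagram up to VRI, VRII, VRIII, SV is determined by its signed Gauss diagram (one arrow per classical crossing, from over- to under-passage, labelled by the sign of the crossing); $F_1$ exchanges two adjacent arrow tails. Twist move at a classical crossing $c$: replace a small neighbourhood of $c$, viewed as a 2-strand tangle consisting of the single crossing $c$, by the 2-strand tangle obtained by placing a welded crossing of the two strands on each of two opposite sides of the classical crossing (a vertical stack welded–classical–welded), the classical crossing being drawn with the same picture, and the four endpoints being kept; the inverse replacement is also a twist move. The effect is to exchange the over- and under-passing strands at $c$ while preserving the sign of $c$; on the Gauss diagram it reverses the arrow of $c$ and keeps its sign. *)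

theory Defs
  imports Main
begin

text \<open>
  A diagram is cut by horizontal lines into elementary slices, each containing a single minimum
  (\<open>Cup\<close>), a single maximum (\<open>Cap\<close>) or a single double point (\<open>X c\<close>) besides vertical
  strands, and is read from bottom to top. Every generic immersed closed curve in the plane becomes
  such a stack of slices after a planar isotopy.

  No orientation is needed. At a double point drawn with one strand from bottom left to top right and
  the other from bottom right to top left, \<open>Rise\<close> says that the former is the over-strand, \<open>Fall\<close> that
  the latter is, and \<open>Weld\<close> that the double point is a welded crossing. Turning a crossing by a
  quarter turn exchanges \<open>Rise\<close> and \<open>Fall\<close>, which is \<open>flip\<close>.
\<close>

datatype crossing = Rise | Fall | Weld

fun flip :: "crossing \<Rightarrow> crossing" where
  "flip Rise = Fall"
| "flip Fall = Rise"
| "flip Weld = Weld"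

datatype piece = Cup | Cap | X crossing

fun ins :: "piece \<Rightarrow> nat" where
  "ins Cup = 0"
| "ins Cap = 2"
| "ins (X c) = 2"

fun outs :: "piece \<Rightarrow> nat" where
  "outs Cup = 2"
| "outs Cap = 0"
| "outs (X c) = 2"

text \<open>
  In the slice \<open>(e, i)\<close> the piece \<open>e\<close> has exactly \<open>i\<close> vertical strands to its left; strands are
  numbered from left to right, starting with 0.
\<close>

type_synonym slice = "piece \<times> nat"

text \<open>\<open>tangle n w m\<close>: the slices \<open>w\<close> fit together, with \<open>n\<close> strands at the bottom and \<open>m\<close> at the top.\<close>

fun tangle :: "nat \<Rightarrow> slice list \<Rightarrow> nat \<Rightarrow> bool" where
  "tangle n [] m \<longleftrightarrow> n = m"
| "tangle n ((e, i) # w) m \<longleftrightarrow> i + ins e \<le> n \<and> tangle (n - ins e + outs e) w m"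

definition closed_diagram :: "slice list \<Rightarrow> bool" where
  "closed_diagram w \<longleftrightarrow> tangle 0 w 0"

text \<open>
  The curve drawn by \<open>w\<close>: a point \<open>(k, j)\<close> is the intersection of the curve with the \<open>k\<close>-th horizontal
  line at strand \<open>j\<close>, and \<open>arcs k n w\<close> lists the arcs joining these points inside the slices \<open>w\<close>
  stacked on the \<open>k\<close>-th line, on which there are \<open>n\<close> strands. The two strands of a double point cross.
\<close>

fun piece_arcs :: "nat \<Rightarrow> slice \<Rightarrow> ((nat \<times> nat) \<times> (nat \<times> nat)) set" where
  "piece_arcs k (Cup, i) = {((Suc k, i), (Suc k, Suc i))}"
| "piece_arcs k (Cap, i) = {((k, i), (k, Suc i))}"
| "piece_arcs k (X c, i) = {((k, i), (Suc k, Suc i)), ((k, Suc i), (Suc k, i))}"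

definition vertical_arcs :: "nat \<Rightarrow> nat \<Rightarrow> slice \<Rightarrow> ((nat \<times> nat) \<times> (nat \<times> nat)) set" where
  "vertical_arcs k n s = (case s of (e, i) \<Rightarrow>
     {((k, j), (Suc k, j)) | j. j < i} \<union>
     {((k, j), (Suc k, j - ins e + outs e)) | j. i + ins e \<le> j \<and> j < n})"

fun arcs :: "nat \<Rightarrow> nat \<Rightarrow> slice list \<Rightarrow> ((nat \<times> nat) \<times> (nat \<times> nat)) set" where
  "arcs k n [] = {}"
| "arcs k n ((e, i) # w) =
     piece_arcs k (e, i) \<union> vertical_arcs k n (e, i) \<union> arcs (Suc k) (n - ins e + outs e) w"

text \<open>
  In a closed diagram each point lies on exactly two arcs, so the curve is a union of immersed
  circles; it is a single circle iff it is nonempty and connected through arcs.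
\<close>

definition one_circle :: "slice list \<Rightarrow> bool" where
  "one_circle w \<longleftrightarrow> (let A = arcs 0 0 w in
     Field A \<noteq> {} \<and> (\<forall>p\<in>Field A. \<forall>q\<in>Field A. (p, q) \<in> (A \<union> A\<inverse>)\<^sup>*))"

definition welded_knot_diagram :: "slice list \<Rightarrow> bool" where
  "welded_knot_diagram w \<longleftrightarrow> closed_diagram w \<and> one_circle w"

definition trivial_diagram :: "slice list" where
  "trivial_diagram = [(Cup, 0), (Cap, 0)]"

text \<open>
  Planar isotopy of sliced diagrams: exchanging the heights of two pieces lying side by side,
  straightening a zigzag, and pushing a double point through a minimum or a maximum. In the last
  two rules the crossing strand turns by a quarter turn relative to the other one, hence \<open>flip\<close>.
\<close>

inductive isotopy_move :: "slice list \<Rightarrow> slice list \<Rightarrow> bool" where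
  interchange: "isotopy_move [(a, i), (b, i + outs a + k)] [(b, i + ins a + k), (a, i)]"
| zigzag_left: "isotopy_move [(Cup, i), (Cap, Suc i)] []"
| zigzag_right: "isotopy_move [(Cup, Suc i), (Cap, i)] []"
| through_cup: "isotopy_move [(Cup, i), (X c, Suc i)] [(Cup, Suc i), (X (flip c), i)]"
| through_cap: "isotopy_move [(X c, Suc i), (Cap, i)] [(X (flip c), i), (Cap, Suc i)]"

text \<open>
  In the two sides of a Reidemeister-III-type move below, let strands 1, 2, 3 start at the bottom
  from left to right; then \<open>a\<close>, \<open>b\<close>, \<open>c\<close> are the crossings of 1 with 2, of 1 with 3 and of 2 with 3,
  and \<open>Rise\<close> means that the strand with the smaller number is on top.
\<close>

definition RIII_types :: "(crossing \<times> crossing \<times> crossing) set" where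
  "RIII_types =
     {(Rise, Rise, Rise), (Rise, Rise, Fall), (Rise, Fall, Fall),
      (Fall, Rise, Rise), (Fall, Fall, Rise), (Fall, Fall, Fall)}"

definition VRIII_types :: "(crossing \<times> crossing \<times> crossing) set" where
  "VRIII_types = {(Weld, Weld, Weld)}"

definition SV_types :: "(crossing \<times> crossing \<times> crossing) set" where
  "SV_types = (\<Union>c\<in>{Rise, Fall}. {(c, Weld, Weld), (Weld, c, Weld), (Weld, Weld, c)})"

text \<open>Strand 1, strand 2, strand 3 respectively passes over the other two.\<close>

definition F1_types :: "(crossing \<times> crossing \<times> crossing) set" where
  "F1_types = {(Rise, Rise, Weld), (Fall, Weld, Rise), (Weld, Fall, Fall)}"

text \<open>
  For \<open>c = Weld\<close> the rules \<open>RI_cup\<close>, \<open>RI_cap\<close> and \<open>RII\<close> are the moves VRI and VRII.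
  All other positions of the local pictures are obtained from these by planar isotopy.
\<close>

inductive welded_reidemeister_move :: "slice list \<Rightarrow> slice list \<Rightarrow> bool" where
  RI_cup: "welded_reidemeister_move [(Cup, i), (X c, i)] [(Cup, i)]"
| RI_cap: "welded_reidemeister_move [(X c, i), (Cap, i)] [(Cap, i)]"
| RII: "welded_reidemeister_move [(X c, i), (X (flip c), i)] []"
| RIII: "(a, b, c) \<in> RIII_types \<union> VRIII_types \<union> SV_types \<union> F1_types \<Longrightarrow>
    welded_reidemeister_move
      [(X a, i), (X b, Suc i), (X c, i)] [(X c, Suc i), (X b, i), (X a, Suc i)]"

text \<open>
  Placing the welded crossings to the left and right of the classical crossing amounts to
  this move after a quarter turn of the picture, which is a planar isotopy.
\<close>

inductive twist_move :: "slice list \<Rightarrow> slice list \<Rightarrow> bool" where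
  "c \<noteq> Weld \<Longrightarrow> twist_move [(X c, i)] [(X Weld, i), (X c, i), (X Weld, i)]"

text \<open>
  \<open>apply_move R D D'\<close>: \<open>D'\<close> arises from \<open>D\<close> by one local replacement \<open>R\<close>, in either direction. As both
  \<open>D\<close> and \<open>D'\<close> are required to be diagrams, the strands that \<open>R\<close> refers to do exist.
\<close>

definition apply_move ::
    "(slice list \<Rightarrow> slice list \<Rightarrow> bool) \<Rightarrow> slice list \<Rightarrow> slice list \<Rightarrow> bool" where
  "apply_move R D D' \<longleftrightarrow> closed_diagram D \<and> closed_diagram D' \<and>
     (\<exists>u v l r. (R l r \<or> R r l) \<and> D = u @ l @ v \<and> D' = u @ r @ v)"

definition welded_step :: "slice list \<Rightarrow> slice list \<Rightarrow> bool" where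
  "welded_step D D' \<longleftrightarrow> apply_move isotopy_move D D' \<or> apply_move welded_reidemeister_move D D'"

definition twist_step :: "slice list \<Rightarrow> slice list \<Rightarrow> bool" where
  "twist_step = apply_move twist_move"

end

theory Submission
  imports Defs
begin

text \<open>
  In the Gauss diagram of a welded knot, a twist move reverses an arrow and \<open>F1\<close> exchanges adjacent
  tails. Reversing arrows before and after an exchange shows that any two adjacent arrow ends may be
  exchanged. Hence an end of an arrow can travel along the knot until it reaches the other end of that
  arrow, and then the first Reidemeister move deletes the arrow.

  In a sliced diagram an arrow becomes a \<^emph>\<open>chord\<close> between two strands at one height: welded crossings
  bring the strands together, a welded and a classical crossing follow, and welded crossings carry the
  strands back. A classical crossing is a welded crossing followed by a chord. The twist move makes a
  chord symmetric in its two strands, and then \<open>F1\<close> and \<open>SV\<close> show that a chord passes every crossing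
  (\<open>chord_cross\<close>). At a minimum or a maximum one end of a chord may change over to the other leg
  (\<open>chord_slides_under_cup\<close>, \<open>chord_slides_over_cap\<close>), and a chord joining the two legs disappears.

  To have all strands within reach at one height, the diagram is put in plat form, with all minima at
  the bottom and all maxima at the top (\<open>plat_form\<close>). Sliding one end of a chord along the curve
  reaches the whole circle, so the chord is removed (\<open>chord_removable\<close>) and every classical crossing
  becomes welded (\<open>weld_all_crossings\<close>). What remains is a plat whose crossings follow the rules of
  transpositions. A normal form for permutations exhibits either a zigzag, which is straightened to
  give a smaller plat, or a separate circle (\<open>weld_plat_trivial\<close>).

  Both places use that the diagram is one circle. This hypothesis has to survive arbitrary moves, and
  it is carried along as a number: the curve has at most two colorings by two colors that are constant
  along arcs. The number of such colorings is defined slice by slice and is invariant under all moves.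
\<close>

section \<open>Upper parts of diagrams up to moves\<close>

text \<open>
  For a word that closes up at the top, counting downwards from the top determines the number of
  strands at the bottom.
\<close>

fun word_width :: "slice list \<Rightarrow> nat" where
  "word_width [] = 0"
| "word_width ((e, i) # w) = word_width w - outs e + ins e"

definition valid :: "slice list \<Rightarrow> bool" where
  "valid w \<longleftrightarrow> tangle (word_width w) w 0"

lemma tangle_word_width: "tangle n w 0 \<Longrightarrow> n = word_width w"
proof (induction w arbitrary: n)
  case (Cons s w)
  then show ?case by (cases s) force
qed simp

lemma valid_Nil [simp]: "valid []"
  by (simp add: valid_def)

lemma valid_Cons [simp]: "valid ((e, i) # w) \<longleftrightarrow> valid w \<and> i + outs e \<le> word_width w"
proof -
  have "tangle (word_width w - outs e + outs e) w 0 \<Longrightarrow> word_width w - outs e + outs e = word_width w"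
    by (rule tangle_word_width)
  then show ?thesis by (auto simp: valid_def)
qed

text \<open>
  The moves are applied to words that close up at the top over any number of strands at the bottom.
  Such words are built by adding slices at the bottom, and over no strands the relation is that of
  the theorem.
\<close>

definition any_move :: "slice list \<Rightarrow> slice list \<Rightarrow> bool" where
  "any_move l r \<longleftrightarrow> isotopy_move l r \<or> welded_reidemeister_move l r \<or> twist_move l r"

definition move_step :: "slice list \<Rightarrow> slice list \<Rightarrow> bool" where
  "move_step w w' \<longleftrightarrow> valid w \<and> valid w' \<and> word_width w = word_width w' \<and>
     (\<exists>u v l r. (any_move l r \<or> any_move r l) \<and> w = u @ l @ v \<and> w' = u @ r @ v)"

definition move_equiv :: "slice list \<Rightarrow> slice list \<Rightarrow> bool" where
  "move_equiv w w' \<longleftrightarrow> valid w \<and> move_step\<^sup>*\<^sup>* w w'"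

lemma move_step_sym: "move_step w w' \<Longrightarrow> move_step w' w"
  unfolding move_step_def by metis

lemma move_equiv_refl: "move_equiv w w \<longleftrightarrow> valid w"
  by (simp add: move_equiv_def)

lemma move_equiv_inv: "move_equiv w w' \<Longrightarrow> valid w \<and> valid w' \<and> word_width w = word_width w'"
  unfolding move_equiv_def
  by (auto elim!: rtranclp_induct simp: move_step_def)

lemma move_equiv_sym: "move_equiv w w' \<Longrightarrow> move_equiv w' w"
  using move_equiv_inv[of w w'] symp_rtranclp[of move_step]
  by (auto simp: move_equiv_def symp_def move_step_sym)

lemma move_equiv_trans: "move_equiv w w' \<Longrightarrow> move_equiv w' w'' \<Longrightarrow> move_equiv w w''"
  by (auto simp: move_equiv_def)

lemma move_equiv_move:
  assumes "any_move l r" "valid (l @ v)" "valid (r @ v)" "word_width (l @ v) = word_width (r @ v)"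
  shows "move_equiv (l @ v) (r @ v)"
proof -
  have "move_step (l @ v) (r @ v)"
    unfolding move_step_def using assms by (metis append_Nil)
  then show ?thesis using assms by (simp add: move_equiv_def)
qed

lemma move_step_Cons:
  assumes "move_step w w'" "valid (s # w)"
  shows "move_step (s # w) (s # w')"
proof -
  obtain u v l r where *: "any_move l r \<or> any_move r l" "w = u @ l @ v" "w' = u @ r @ v"
    using assms(1) unfolding move_step_def by blast
  obtain e i where s: "s = (e, i)" by force
  have "valid (s # w')" "word_width (s # w) = word_width (s # w')"
    using assms by (auto simp: s move_step_def)
  moreover have "s # w = (s # u) @ l @ v" "s # w' = (s # u) @ r @ v" using * by auto
  ultimately show ?thesis using *(1) assms(2) unfolding move_step_def by blast
qed

lemma move_equiv_Cons:
  assumes "move_equiv w w'" "valid (s # w)"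
  shows "move_equiv (s # w) (s # w')"
proof -
  have "move_step\<^sup>*\<^sup>* w w'" using assms by (simp add: move_equiv_def)
  then have "move_equiv (s # w) (s # w')"
  proof induction
    case base
    then show ?case using assms by (simp add: move_equiv_refl)
  next
    case (step y z)
    then have "move_step (s # y) (s # z)"
      using move_equiv_inv move_step_Cons by blast
    then show ?case using step.IH
      by (auto simp: move_equiv_def intro: rtranclp.rtrancl_into_rtrancl)
  qed
  then show ?thesis .
qed

text \<open>
  An element is the part of a closed diagram above a horizontal line. In the quotient the moves become
  equations, which can be used by rewriting above any slices that are added at the bottom.
\<close>

quotient_type upper = "slice list" / partial: move_equiv
proof (rule part_equivpI)
  show "\<exists>w. move_equiv w w" using move_equiv_refl valid_Nil by blast
  show "symp move_equiv" by (auto intro: sympI move_equiv_sym)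
  show "transp move_equiv" by (auto intro: transpI move_equiv_trans)
qed

lift_definition width :: "upper \<Rightarrow> nat" is word_width
  using move_equiv_inv by blast

lift_definition void :: upper is "[]"
  by (simp add: move_equiv_refl)

text \<open>
  A slice that does not fit leaves the class unchanged; this makes \<open>put\<close> total, and the equations
  below are conditional on the number of strands.
\<close>

lift_definition put :: "piece \<Rightarrow> nat \<Rightarrow> upper \<Rightarrow> upper" is
  "\<lambda>e i w. if i + outs e \<le> word_width w then (e, i) # w else w"
  by (auto simp: move_equiv_inv intro: move_equiv_Cons dest: move_equiv_inv)

abbreviation cup :: "nat \<Rightarrow> upper \<Rightarrow> upper" where "cup \<equiv> put Cup"
abbreviation cap :: "nat \<Rightarrow> upper \<Rightarrow> upper" where "cap \<equiv> put Cap"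
abbreviation cross :: "crossing \<Rightarrow> nat \<Rightarrow> upper \<Rightarrow> upper" where "cross c \<equiv> put (X c)"

lemma width_void [simp]: "width void = 0"
  by transfer simp

lemma width_put:
  "width (put e i z) = (if i + outs e \<le> width z then width z - outs e + ins e else width z)"
  by transfer simp

lemma width_cross [simp]: "width (cross c i z) = width z"
  by (auto simp: width_put)

lemma width_cap [simp]: "i \<le> width z \<Longrightarrow> width (cap i z) = Suc (Suc (width z))"
  by (simp add: width_put)

lemma width_cup [simp]: "Suc i < width z \<Longrightarrow> width (cup i z) = width z - 2"
  by (simp add: width_put)

lemma upper_cases:
  obtains w where "z = abs_upper w" "valid w" "width z = word_width w"
proof -
  have *: "valid (rep_upper z)"
    using Quotient_rep_reflp[OF Quotient_upper] move_equiv_refl by blast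
  moreover have "abs_upper (rep_upper z) = z"
    by (rule Quotient_abs_rep[OF Quotient_upper])
  ultimately show ?thesis
    using that[of "rep_upper z"] by (metis move_equiv_refl width.abs_eq)
qed

lemma put_abs:
  "valid w \<Longrightarrow> i + outs e \<le> word_width w \<Longrightarrow> put e i (abs_upper w) = abs_upper ((e, i) # w)"
  by (simp add: put.abs_eq move_equiv_refl)

lemma width_abs: "valid w \<Longrightarrow> width (abs_upper w) = word_width w"
  by (simp add: width.abs_eq move_equiv_refl)

lemma abs_move:
  assumes "any_move l r" "valid (l @ v)" "valid (r @ v)" "word_width (l @ v) = word_width (r @ v)"
  shows "abs_upper (l @ v) = abs_upper (r @ v)"
  using move_equiv_move[OF assms] Quotient_rel_abs[OF Quotient_upper] by blast

lemma upper_induct [case_names void put]: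
  assumes "P void" "\<And>e i z. i + outs e \<le> width z \<Longrightarrow> P z \<Longrightarrow> P (put e i z)"
  shows "P z"
proof -
  have "valid w \<Longrightarrow> P (abs_upper w)" for w
  proof (induction w)
    case Nil
    then show ?case using assms(1) by (simp add: void_def)
  next
    case (Cons s w)
    obtain e i where "s = (e, i)" by force
    with Cons assms(2)[of i e "abs_upper w"] show ?case by (simp add: put_abs width_abs)
  qed
  then show ?thesis using upper_cases by metis
qed

section \<open>The moves as equations\<close>

lemma put_interchange:
  assumes "i + outs a + k + outs b \<le> width z"
  shows "put a i (put b (i + outs a + k) z) = put b (i + ins a + k) (put a i z)"
proof (cases z rule: upper_cases)
  case (1 w)
  then show ?thesis
    using assms abs_move[of "[(a, i), (b, i + outs a + k)]" "[(b, i + ins a + k), (a, i)]" w]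
    by (simp add: any_move_def interchange put_abs)
qed

lemma zigzag_right: "i < width z \<Longrightarrow> cup (Suc i) (cap i z) = z"
proof (cases z rule: upper_cases)
  case (1 w)
  assume "i < width z"
  with 1 show ?thesis using abs_move[of "[(Cup, Suc i), (Cap, i)]" "[]" w]
    by (simp add: any_move_def isotopy_move.zigzag_right put_abs)
qed

lemma through_cup:
  assumes "Suc (Suc i) < width z"
  shows "cup i (cross c (Suc i) z) = cup (Suc i) (cross (flip c) i z)"
proof (cases z rule: upper_cases)
  case (1 w)
  with assms show ?thesis
    using abs_move[of "[(Cup, i), (X c, Suc i)]" "[(Cup, Suc i), (X (flip c), i)]" w]
    by (simp add: any_move_def isotopy_move.through_cup put_abs)
qed

lemma through_cap:
  assumes "i < width z"
  shows "cross c (Suc i) (cap i z) = cross (flip c) i (cap (Suc i) z)"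
proof (cases z rule: upper_cases)
  case (1 w)
  with assms show ?thesis
    using abs_move[of "[(X c, Suc i), (Cap, i)]" "[(X (flip c), i), (Cap, Suc i)]" w]
    by (simp add: any_move_def isotopy_move.through_cap put_abs)
qed

lemma RI_cup:
  assumes "Suc i < width z"
  shows "cup i (cross c i z) = cup i z"
proof (cases z rule: upper_cases)
  case (1 w)
  with assms show ?thesis
    using abs_move[of "[(Cup, i), (X c, i)]" "[(Cup, i)]" w]
    by (simp add: any_move_def welded_reidemeister_move.RI_cup put_abs)
qed

lemma RI_cap:
  assumes "i \<le> width z"
  shows "cross c i (cap i z) = cap i z"
proof (cases z rule: upper_cases)
  case (1 w)
  with assms show ?thesis
    using abs_move[of "[(X c, i), (Cap, i)]" "[(Cap, i)]" w]
    by (simp add: any_move_def welded_reidemeister_move.RI_cap put_abs)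
qed

lemma RII:
  assumes "Suc i < width z"
  shows "cross c i (cross (flip c) i z) = z"
proof (cases z rule: upper_cases)
  case (1 w)
  with assms show ?thesis
    using abs_move[of "[(X c, i), (X (flip c), i)]" "[]" w]
    by (simp add: any_move_def welded_reidemeister_move.RII put_abs)
qed

lemma RIII:
  assumes "(a, b, c) \<in> RIII_types \<union> VRIII_types \<union> SV_types \<union> F1_types"
    and "Suc (Suc i) < width z"
  shows "cross a i (cross b (Suc i) (cross c i z)) = cross c (Suc i) (cross b i (cross a (Suc i) z))"
proof (cases z rule: upper_cases)
  case (1 w)
  then have "Suc i \<le> word_width w - 2" "i \<le> word_width w - 2" using assms by linarith+
  with 1 assms show ?thesis
    using abs_move[of "[(X a, i), (X b, Suc i), (X c, i)]" "[(X c, Suc i), (X b, i), (X a, Suc i)]" w]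
      welded_reidemeister_move.RIII[OF assms(1), of i]
    by (simp add: any_move_def put_abs)
qed

lemma twist:
  assumes "c \<noteq> Weld" "Suc i < width z"
  shows "cross Weld i (cross c i (cross Weld i z)) = cross c i z"
proof (cases z rule: upper_cases)
  case (1 w)
  with assms show ?thesis
    using abs_move[of "[(X c, i)]" "[(X Weld, i), (X c, i), (X Weld, i)]" w]
    by (simp add: any_move_def twist_move.intros put_abs)
qed

lemma cross_far: "Suc i < j \<Longrightarrow> Suc j < width z \<Longrightarrow> cross a i (cross b j z) = cross b j (cross a i z)"
proof -
  assume *: "Suc i < j" "Suc j < width z"
  define k where "k = j - (i + 2)"
  with * have "j = Suc (Suc (i + k))" by simp
  then show ?thesis using * put_interchange[of i "X a" k "X b" z] by simp
qed

lemma cup_cross: "Suc i < j \<Longrightarrow> Suc j < width z \<Longrightarrow> cup i (cross c j z) = cross c (j - 2) (cup i z)"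
proof -
  assume *: "Suc i < j" "Suc j < width z"
  define k where "k = j - (i + 2)"
  with * have "j = Suc (Suc (i + k))" by simp
  then show ?thesis using * put_interchange[of i Cup k "X c" z] by simp
qed

lemma cross_cap: "i \<le> j \<Longrightarrow> Suc j < width z \<Longrightarrow> cross c (Suc (Suc j)) (cap i z) = cap i (cross c j z)"
  using put_interchange[of i Cap "j - i" "X c" z] by auto

lemma weld_weld [simp]: "Suc i < width z \<Longrightarrow> cross Weld i (cross Weld i z) = z"
  using RII[of i z Weld] by simp

lemma VRIII: "Suc (Suc i) < width z \<Longrightarrow>
    cross Weld i (cross Weld (Suc i) (cross Weld i z)) = cross Weld (Suc i) (cross Weld i (cross Weld (Suc i) z))"
  by (rule RIII) (auto simp: VRIII_types_def)

lemma SV_first: "c \<noteq> Weld \<Longrightarrow> Suc (Suc i) < width z \<Longrightarrow>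
    cross c i (cross Weld (Suc i) (cross Weld i z)) = cross Weld (Suc i) (cross Weld i (cross c (Suc i) z))"
  by (rule RIII) (cases c; auto simp: SV_types_def)+

lemma SV_last: "c \<noteq> Weld \<Longrightarrow> Suc (Suc i) < width z \<Longrightarrow>
    cross Weld i (cross Weld (Suc i) (cross c i z)) = cross c (Suc i) (cross Weld i (cross Weld (Suc i) z))"
  by (rule RIII) (cases c; auto simp: SV_types_def)+

lemma weld_comm:
  assumes "c \<noteq> Weld" "Suc i < width z"
  shows "cross c i (cross Weld i z) = cross Weld i (cross c i z)"
  using twist[OF assms(1), of i "cross Weld i z"] assms by simp

section \<open>Chords\<close>

definition exchange :: "nat \<Rightarrow> nat \<Rightarrow> nat" where
  "exchange p a = (if a = p then Suc p else if a = Suc p then p else a)"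

text \<open>
  \<open>ordered_chord i j c\<close> joins strands \<open>i < j\<close>: strand \<open>j\<close> is carried next to strand \<open>i\<close>, the pair is
  linked by a welded and a classical crossing, and strand \<open>j\<close> is carried back. The two crossings
  together preserve the order of the strands.
\<close>

fun ordered_chord :: "nat \<Rightarrow> nat \<Rightarrow> crossing \<Rightarrow> upper \<Rightarrow> upper" where
  "ordered_chord i 0 c z = z"
| "ordered_chord i (Suc j) c z =
     (if i < j then cross Weld j (ordered_chord i j c (cross Weld j z)) else cross Weld j (cross c j z))"

definition chord :: "nat \<Rightarrow> nat \<Rightarrow> crossing \<Rightarrow> upper \<Rightarrow> upper" where
  "chord i j = (if i < j then ordered_chord i j else ordered_chord j i)"

lemma width_ordered_chord [simp]: "width (ordered_chord i j c z) = width z"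
  by (induction j arbitrary: z) auto

lemma width_chord [simp]: "width (chord i j c z) = width z"
  by (simp add: chord_def)

lemma chord_sym: "chord i j = chord j i"
  by (cases i j rule: linorder_cases) (auto simp: chord_def)

lemma ordered_chord_above:
  "i < j \<Longrightarrow> j < p \<Longrightarrow> Suc p < width z \<Longrightarrow> ordered_chord i j c (cross d p z) = cross d p (ordered_chord i j c z)"
  by (induction j arbitrary: z) (auto simp: cross_far[of _ p])

lemma ordered_chord_below:
  "Suc p < i \<Longrightarrow> i < j \<Longrightarrow> j < width z \<Longrightarrow> ordered_chord i j c (cross d p z) = cross d p (ordered_chord i j c z)"
  by (induction j arbitrary: z) (auto simp: cross_far[of p, symmetric])

text \<open>
  Exchanging the outer strand \<open>p\<close> with its right neighbour moves the end of the chord; next to the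
  other end this is \<open>SV\<close> together with \<open>VRIII\<close>.
\<close>

lemma ordered_chord_left:
  "c \<noteq> Weld \<Longrightarrow> Suc p < j \<Longrightarrow> j < width z \<Longrightarrow>
    ordered_chord p j c (cross Weld p z) = cross Weld p (ordered_chord (Suc p) j c z)"
proof (induction j arbitrary: z)
  case (Suc j)
  show ?case
  proof (cases "j = Suc p")
    case True
    let ?w = "cross Weld p" and ?v = "cross Weld (Suc p)"
    have "?v (?w (cross c p (?v (?w z)))) = ?v (?w (?v (?w (cross c (Suc p) z))))"
      using SV_first[of c p z] Suc.prems True by simp
    also have "\<dots> = ?w (?v (cross c (Suc p) z))"
      using VRIII[of p "?w (cross c (Suc p) z)"] Suc.prems True by simp
    finally show ?thesis using True by simp
  next
    case False
    with Suc.prems have "Suc p < j" by simp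
    then show ?thesis using Suc by (simp add: cross_far[of p, symmetric])
  qed
qed simp

lemma ordered_chord_left':
  "c \<noteq> Weld \<Longrightarrow> Suc p < j \<Longrightarrow> j < width z \<Longrightarrow>
    ordered_chord (Suc p) j c (cross Weld p z) = cross Weld p (ordered_chord p j c z)"
  using ordered_chord_left[of c p j "cross Weld p z"] by simp

text \<open>
  A welded crossing between two strands that only lie between the ends of the chord is moved through
  by the third move \<open>VRIII\<close> on both halves of the chord.
\<close>

lemma ordered_chord_mid:
  "i < p \<Longrightarrow> Suc p < j \<Longrightarrow> j < width z \<Longrightarrow>
    ordered_chord i j c (cross Weld p z) = cross Weld p (ordered_chord i j c z)"
proof (induction j arbitrary: z)
  case (Suc j)
  show ?case
  proof (cases "j = Suc p")
    case True
    let ?w = "cross Weld p" and ?v = "cross Weld (Suc p)" and ?c = "ordered_chord i p c"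
    have "?v (?w (?c (?w (?v (?w z))))) = ?v (?w (?c (?v (?w (?v z)))))"
      using Suc.prems True by (simp add: VRIII)
    also have "\<dots> = ?v (?w (?v (?c (?w (?v z)))))"
      using Suc.prems True by (simp add: ordered_chord_above)
    also have "\<dots> = ?w (?v (?w (?c (?w (?v z)))))"
      using Suc.prems True by (simp add: VRIII)
    finally show ?thesis using True Suc.prems by simp
  next
    case False
    with Suc.prems have "Suc p < j" by simp
    then show ?thesis using Suc by (simp add: cross_far[of p, symmetric])
  qed
qed simp

text \<open>
  A welded crossing permutes the strands, and a chord follows its two strands. The case that the
  crossing exchanges the two ends is the twist move.
\<close>

lemma chord_weld:
  assumes "c \<noteq> Weld" "i \<noteq> j" "i < width z" "j < width z" "Suc p < width z"
  shows "chord i j c (cross Weld p z) = cross Weld p (chord (exchange p i) (exchange p j) c z)"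
proof -
  have *: "chord i j c (cross Weld p z) = cross Weld p (chord (exchange p i) (exchange p j) c z)"
    if ij: "i < j" "j < width z" for i j
  proof -
    consider "j < p" | "j = p" | "Suc p = j" "i = p" | "Suc p = j" "i < p"
      | "Suc p < j" "i < p" | "Suc p < j" "i = p" | "Suc p < j" "i = Suc p" | "Suc p < i"
      using ij by linarith
    then show ?thesis
    proof cases
      case 1 then show ?thesis using ij assms by (simp add: chord_def exchange_def ordered_chord_above)
    next
      case 2 then show ?thesis using ij assms by (simp add: chord_def exchange_def)
    next
      case 3 then show ?thesis using ij assms by (auto simp: chord_def exchange_def weld_comm)
    next
      case 4 then show ?thesis using ij assms by (auto simp: chord_def exchange_def)
    next
      case 5 then show ?thesis using ij assms by (auto simp: chord_def exchange_def ordered_chord_mid)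
    next
      case 6 then show ?thesis using ij assms by (auto simp: chord_def exchange_def ordered_chord_left)
    next
      case 7 then show ?thesis using ij assms by (auto simp: chord_def exchange_def ordered_chord_left')
    next
      case 8 then show ?thesis using ij assms by (auto simp: chord_def exchange_def ordered_chord_below)
    qed
  qed
  then show ?thesis using assms * [of i j] *[of j i] chord_sym by (metis linorder_neqE_nat)
qed

lemma chord_inverse:
  assumes "c \<noteq> Weld" "i \<noteq> j" "i < width z" "j < width z"
  shows "chord i j c (chord i j (flip c) z) = z"
proof -
  have "flip c \<noteq> Weld" using assms by (cases c) auto
  then have "ordered_chord i j c (ordered_chord i j (flip c) z) = z" if "i < j" "j < width z" for i j z
    using that
  proof (induction j arbitrary: z)
    case (Suc j)
    then show ?case using assms(1) by (auto simp: weld_comm RII)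
  qed simp
  then show ?thesis using assms by (auto simp: chord_def)
qed

lemma exchange_exchange [simp]: "exchange p (exchange p a) = a"
  by (auto simp: exchange_def)

lemma exchange_eq_iff [simp]: "exchange p a = exchange p b \<longleftrightarrow> a = b"
  by (metis exchange_exchange)

lemma exchange_less: "Suc p < n \<Longrightarrow> a < n \<Longrightarrow> exchange p a < n"
  by (auto simp: exchange_def)

lemma weld_chord:
  assumes "c \<noteq> Weld" "i \<noteq> j" "i < width z" "j < width z" "Suc p < width z"
  shows "cross Weld p (chord i j c z) = chord (exchange p i) (exchange p j) c (cross Weld p z)"
  using chord_weld[of c "exchange p i" "exchange p j" z p] assms by (simp add: exchange_less)

text \<open>
  \<open>chord i j (flip c)\<close> is inverse to \<open>chord i j c\<close>, so it passes whatever the latter passes.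
\<close>

lemma chord_past_flip:
  assumes "\<And>z. width z = n \<Longrightarrow> chord i j c (cross d l z) = cross d l (chord i' j' c z)"
    and "c \<noteq> Weld" "i \<noteq> j" "i < n" "j < n" "i' \<noteq> j'" "i' < n" "j' < n" "width z = n"
  shows "chord i j (flip c) (cross d l z) = cross d l (chord i' j' (flip c) z)"
proof -
  define y where "y = chord i' j' (flip c) z"
  have c: "flip c \<noteq> Weld" "flip (flip c) = c" using assms(2) by (cases c; simp)+
  have "z = chord i' j' c y" using chord_inverse[of c i' j' z] assms by (simp add: y_def)
  then have "cross d l z = chord i j c (cross d l y)" using assms(1)[of y] assms(9) by (simp add: y_def)
  then show ?thesis
    using chord_inverse[of "flip c" i j "cross d l y"] assms c by (simp add: y_def)
qed

text \<open>
  The core of the argument: chords on the strands \<open>p, p + 1\<close> and \<open>p + 1, p + 2\<close> commute. Writing the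
  classical crossings in the two instances of \<open>F1\<close> below as welded crossings followed by chords turns
  \<open>F1\<close> into this commutation, for the two signs that the crossing \<open>d\<close> may have. The chord of type
  \<open>Fall\<close> is then covered by \<open>chord_past_flip\<close>.
\<close>

lemma chord_shares_strand_Rise:
  assumes "d \<noteq> Weld" "Suc (Suc p) < width z"
  shows "chord (Suc p) (Suc (Suc p)) Rise (cross d p z) = cross d p (chord p (Suc (Suc p)) Rise z)"
proof -
  let ?w = "cross Weld p" and ?v = "cross Weld (Suc p)"
    and ?r = "cross Rise p" and ?s = "cross Rise (Suc p)"
  have "d = Fall \<or> d = Rise" using assms(1) by (cases d) auto
  then show ?thesis
  proof
    assume d: "d = Fall"
    let ?f = "cross Fall p" and ?g = "cross Fall (Suc p)"
    have F1: "?f (?v (?r y)) = ?s (?w (?g y))" if "width y = width z" for y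
      by (rule RIII) (use assms that in \<open>auto simp: F1_types_def\<close>)
    have "?f (?v (?w (?r (?v z)))) = ?f (?v (?r (?w (?v z))))"
      using assms by (simp add: weld_comm)
    also have "\<dots> = ?s (?w (?g (?w (?v z))))"
      using assms by (simp add: F1)
    also have "\<dots> = ?s (?w (?w (?v (?f z))))"
      using assms by (simp add: SV_last)
    also have "\<dots> = ?v (?s (?f z))"
      using assms by (simp add: weld_comm)
    finally show ?thesis by (simp add: chord_def d)
  next
    assume d: "d = Rise"
    have F1: "?r (?s (?w y)) = ?v (?r (?s y))" if "width y = width z" for y
      by (rule RIII) (use assms that in \<open>auto simp: F1_types_def\<close>)
    have "?v (?w (?r (?v z))) = ?w (?v (?s (?w z)))"
      using ordered_chord_left[of Rise p "Suc (Suc p)" "?w z"] assms by simp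
    then have "?r (?v (?w (?r (?v z)))) = ?r (?w (?v (?s (?w z))))" by simp
    also have "\<dots> = ?w (?r (?s (?v (?w z))))"
      using assms by (simp add: weld_comm)
    also have "\<dots> = ?w (?v (?r (?s (?v (?w (?v z))))))"
      using F1[of "?w (?v (?w z))"] assms by (simp add: VRIII)
    also have "\<dots> = ?w (?v (?r (?v (?s (?w (?v z))))))"
      using assms by (simp add: weld_comm)
    also have "\<dots> = ?w (?v (?r (?w (?v (?w (?r z))))))"
      using assms by (simp add: SV_last[symmetric] VRIII)
    also have "\<dots> = ?w (?v (?w (?r (?v (?w (?r z))))))"
      using assms by (simp add: weld_comm)
    also have "\<dots> = ?w (?v (?w (?v (?w (?s (?r z))))))"
      using assms by (simp add: SV_first)
    also have "\<dots> = ?v (?s (?r z))"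
      using assms by (simp add: VRIII)
    finally show ?thesis by (simp add: chord_def d)
  qed
qed

lemma chord_shares_strand:
  assumes "c \<noteq> Weld" "d \<noteq> Weld" "Suc (Suc p) < width z"
  shows "chord (Suc p) (Suc (Suc p)) c (cross d p z) = cross d p (chord p (Suc (Suc p)) c z)"
proof -
  have "c = Rise \<or> c = flip Rise" using assms(1) by (cases c) auto
  then show ?thesis
  proof
    assume "c = flip Rise"
    then show ?thesis
      using assms chord_shares_strand_Rise
        chord_past_flip[of "width z" "Suc p" "Suc (Suc p)" Rise d p p "Suc (Suc p)" z] by simp
  qed (use assms chord_shares_strand_Rise in auto)
qed

text \<open>
  For a crossing of the two leftmost strands, an end of the chord far to the right can be brought next
  to them by welded crossings that do not meet the crossing. This leaves the chord that shares both
  strands with the crossing, the two chords that share one strand, and chords disjoint from it.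
\<close>

lemma chord_cross_leftmost:
  assumes "c \<noteq> Weld" "d \<noteq> Weld" "i < j" "j < width z"
  shows "chord i j c (cross d 0 z) = cross d 0 (chord (exchange 0 i) (exchange 0 j) c z)"
proof -
  have right: "ordered_chord (Suc 0) j c (cross d 0 z) = cross d 0 (ordered_chord 0 j c z)"
    if "Suc 0 < j" "j < width z" for j z
    using that
  proof (induction j arbitrary: z)
    case (Suc j)
    show ?case
    proof (cases "j = Suc 0")
      case True
      then show ?thesis using chord_shares_strand[OF assms(1,2), of 0 z] Suc.prems
        by (simp add: chord_def)
    next
      case False
      then show ?thesis using Suc by (simp add: cross_far[of 0, symmetric])
    qed
  qed simp
  consider "i = 0" "j = 1" | "i = 0" "Suc 0 < j" | "i = 1" "Suc 0 < j" | "Suc 0 < i"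
    using assms by linarith
  then show ?thesis
  proof cases
    case 1
    have "c = d \<or> c = flip d" "flip (flip d) = d" using assms(1,2) by (cases c; cases d; simp)+
    then have "cross c 0 (cross d 0 z) = cross d 0 (cross c 0 z)"
      using 1 assms(3,4) RII[of 0 z d] RII[of 0 z c] by auto
    with 1 assms show ?thesis
      by (simp add: chord_def exchange_def weld_comm)
  next
    case 2
    have *: "ordered_chord 0 j c y = cross Weld 0 (ordered_chord (Suc 0) j c (cross Weld 0 y))" if "width y = width z" for y
      using ordered_chord_left'[of c 0 j y] 2 assms that by simp
    have "cross Weld 0 (ordered_chord (Suc 0) j c (cross Weld 0 (cross d 0 z))) = cross d 0 (ordered_chord (Suc 0) j c z)"
      using 2 assms ordered_chord_left[of c 0 j z] by (simp add: weld_comm[symmetric] right)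
    then show ?thesis using * 2 by (simp add: chord_def exchange_def)
  next
    case 3
    then show ?thesis using assms right by (simp add: chord_def exchange_def)
  next
    case 4
    then show ?thesis using assms ordered_chord_below by (simp add: chord_def exchange_def)
  qed
qed

text \<open>
  Conjugating by two welded crossings moves a classical crossing one step to the left (\<open>SV\<close>), and
  the chord follows, so the crossing may be assumed to be leftmost.
\<close>

lemma chord_classical:
  assumes "c \<noteq> Weld" "d \<noteq> Weld" "i \<noteq> j" "i < width z" "j < width z" "Suc l < width z"
  shows "chord i j c (cross d l z) = cross d l (chord (exchange l i) (exchange l j) c z)"
  using assms
proof (induction l arbitrary: i j z)
  case 0
  then consider "i < j" | "j < i" by linarith
  then show ?case
    using 0 chord_cross_leftmost[of c d i j z] chord_cross_leftmost[of c d j i z]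
    by cases (simp_all add: chord_sym[of j] chord_sym[of "exchange 0 j"])
next
  case (Suc l)
  let ?w = "cross Weld l" and ?v = "cross Weld (Suc l)"
  have conj: "cross d (Suc l) y = ?w (?v (cross d l (?v (?w y))))" if "width y = width z" for y
    using SV_last[of d l "?v (?w y)"] that Suc.prems by simp
  \<comment> \<open>both sides are the transposition of \<open>l + 1\<close> and \<open>l + 2\<close> conjugated to a neighbouring one\<close>
  have sw3: "exchange l (exchange (Suc l) (exchange l (exchange (Suc l) (exchange l a)))) = exchange (Suc l) a" for a
    by (auto simp: exchange_def)
  have "chord i j c (?w (?v (cross d l (?v (?w z))))) =
      ?w (?v (cross d l (?v (?w (chord (exchange (Suc l) i) (exchange (Suc l) j) c z)))))"
    using Suc.prems by (simp add: chord_weld exchange_less Suc.IH sw3)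
  then show ?case by (simp add: conj)
qed

lemma chord_cross:
  assumes "c \<noteq> Weld" "i \<noteq> j" "i < width z" "j < width z" "Suc l < width z"
  shows "chord i j c (cross d l z) = cross d l (chord (exchange l i) (exchange l j) c z)"
  using assms chord_classical chord_weld by (cases "d = Weld") auto

text \<open>
  Displacing a maximum or a minimum sideways past one strand; iterating this brings it to the far left.
\<close>

lemma cap_Suc: "i < width z \<Longrightarrow> cap (Suc i) z = cross Weld i (cross Weld (Suc i) (cap i z))"
  by (simp add: through_cap)

lemma cup_Suc:
  "Suc (Suc i) < width z \<Longrightarrow> cup (Suc i) z = cup i (cross Weld (Suc i) (cross Weld i z))"
  by (simp add: through_cup)

text \<open>
  Past a maximum the strand runs in the opposite vertical direction, so that the crossing in the chord
  is turned by a quarter and \<open>c\<close> becomes \<open>flip c\<close>. For a maximum on the far left and the other end next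
  to it, this is \<open>through_cap\<close> applied twice; welded crossings reduce to that case.
\<close>

lemma chord_slides_over_cap:
  assumes "c \<noteq> Weld" "i \<le> width z" "u \<noteq> i" "u \<noteq> Suc i" "u < width z + 2"
  shows "chord i u c (cap i z) = chord (Suc i) u (flip c) (cap i z)"
  using assms
proof (induction i arbitrary: u)
  case 0
  then have fc: "flip c \<noteq> Weld" "flip (flip c) = c" by (cases c; simp)+
  have "ordered_chord 0 u c (cap 0 z) = ordered_chord (Suc 0) u (flip c) (cap 0 z)"
    if "Suc 0 < u" "u < width z + 2" for u z
    using that
  proof (induction u arbitrary: z)
    case (Suc u)
    show ?case
    proof (cases "u = Suc 0")
      case True
      have "cross Weld (Suc 0) (cap 0 z) = cross Weld 0 (cap (Suc 0) z)"
        using through_cap[of 0 z Weld] Suc.prems True by simp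
      then show ?thesis using True Suc.prems fc \<open>c \<noteq> Weld\<close>
        by (simp add: through_cap twist)
    next
      case False
      define k where "k = u - 2"
      with False have k: "u = Suc (Suc k)" using Suc.prems by simp
      have "cross Weld u (cap 0 z) = cap 0 (cross Weld k z)"
        using cross_cap[of 0 k z] Suc.prems k by simp
      moreover have "ordered_chord 0 u c (cap 0 (cross Weld k z)) = ordered_chord (Suc 0) u (flip c) (cap 0 (cross Weld k z))"
        using Suc.IH[of "cross Weld k z"] Suc.prems k by simp
      ultimately show ?thesis using False Suc.prems k by simp
    qed
  qed simp
  then show ?case using 0 by (simp add: chord_def)
next
  case (Suc i)
  have fc: "flip c \<noteq> Weld" using Suc.prems by (cases c; simp)
  define u' where "u' = exchange (Suc i) (exchange i u)"
  have u': "u' \<noteq> i" "u' \<noteq> Suc i" "u' < width z + 2" using Suc.prems by (auto simp: u'_def exchange_def)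
  have s: "exchange (Suc i) (exchange i (Suc i)) = i" "exchange (Suc i) (exchange i (Suc (Suc i))) = Suc i"
    by (auto simp: exchange_def)
  have "chord (Suc i) u c (cap (Suc i) z) = cross Weld i (cross Weld (Suc i) (chord i u' c (cap i z)))"
    using Suc.prems by (simp add: cap_Suc chord_weld exchange_less s u'_def)
  also have "\<dots> = cross Weld i (cross Weld (Suc i) (chord (Suc i) u' (flip c) (cap i z)))"
    using Suc.IH[of u'] Suc.prems u' by simp
  also have "\<dots> = chord (Suc (Suc i)) u (flip c) (cap (Suc i) z)"
    using Suc.prems fc by (simp add: cap_Suc chord_weld exchange_less s u'_def)
  finally show ?case .
qed

lemma cap_absorbs_chord: "i \<le> width z \<Longrightarrow> chord i (Suc i) c (cap i z) = cap i z"
  by (simp add: chord_def RI_cap)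

lemma chord_slides_under_cup:
  assumes "c \<noteq> Weld" "Suc i < width z" "u \<noteq> i" "u \<noteq> Suc i" "u < width z"
  shows "cup i (chord i u c z) = cup i (chord (Suc i) u (flip c) z)"
  using assms
proof (induction i arbitrary: u z)
  case 0
  then have fc: "flip c \<noteq> Weld" "flip (flip c) = c" by (cases c; simp)+
  have "cup 0 (ordered_chord 0 u c z) = cup 0 (ordered_chord (Suc 0) u (flip c) z)"
    if "Suc 0 < u" "u < width z" for u z
    using that
  proof (induction u arbitrary: z)
    case (Suc u)
    show ?case
    proof (cases "u = Suc 0")
      case True
      have t: "cup 0 (cross d (Suc 0) y) = cup (Suc 0) (cross (flip d) 0 y)" if "width y = width z" for d y
        using through_cup[of 0 y d] that Suc.prems True by simp
      then show ?thesis using True Suc.prems fc \<open>c \<noteq> Weld\<close>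
        by (simp add: weld_comm[symmetric])
    next
      case False
      then show ?thesis using Suc by (simp add: cup_cross)
    qed
  qed simp
  then show ?case using 0 by (simp add: chord_def)
next
  case (Suc i)
  have fc: "flip c \<noteq> Weld" using Suc.prems by (cases c; simp)
  define u' where "u' = exchange (Suc i) (exchange i u)"
  define y where "y = cross Weld (Suc i) (cross Weld i z)"
  have u': "u' \<noteq> i" "u' \<noteq> Suc i" "u' < width z" using Suc.prems by (auto simp: u'_def exchange_def)
  have s: "exchange (Suc i) (exchange i (Suc i)) = i" "exchange (Suc i) (exchange i (Suc (Suc i))) = Suc i"
    by (auto simp: exchange_def)
  have "cup (Suc i) (chord (Suc i) u c z) = cup i (chord i u' c y)"
    using Suc.prems by (simp add: cup_Suc weld_chord exchange_less s u'_def y_def)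
  also have "\<dots> = cup i (chord (Suc i) u' (flip c) y)"
    using Suc.IH[of y u'] Suc.prems u' by (simp add: y_def)
  also have "\<dots> = cup (Suc i) (chord (Suc (Suc i)) u (flip c) z)"
    using Suc.prems fc by (simp add: cup_Suc weld_chord exchange_less s u'_def y_def)
  finally show ?case .
qed

lemma cup_absorbs_chord: "Suc i < width z \<Longrightarrow> cup i (chord i (Suc i) c z) = cup i z"
  by (simp add: chord_def RI_cup)

section \<open>Two-colorings and circles\<close>

text \<open>
  A coloring gives one of two colors to every point of the curve and is constant along arcs. The colors
  of the bottom strands are a function on all natural numbers, whose values beyond the last strand are
  shifted along with the others. Above a minimum two strands of one new color are inserted, and two
  strands can meet in a maximum only if their colors agree.
\<close>

definition add_pair :: "nat \<Rightarrow> bool \<Rightarrow> (nat \<Rightarrow> bool) \<Rightarrow> nat \<Rightarrow> bool" where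
  "add_pair i b f j = (if j < i then f j else if j < i + 2 then b else f (j - 2))"

definition drop_pair :: "nat \<Rightarrow> (nat \<Rightarrow> bool) \<Rightarrow> nat \<Rightarrow> bool" where
  "drop_pair i f j = (if j < i then f j else f (j + 2))"

text \<open>
  The number of colorings that extend the colors \<open>f\<close> of the bottom strands. Every minimum doubles the
  possibilities; a closed diagram of \<open>m\<close> circles has \<open>2 ^ m\<close> colorings.
\<close>

fun num_colorings :: "slice list \<Rightarrow> (nat \<Rightarrow> bool) \<Rightarrow> nat" where
  "num_colorings [] f = 1"
| "num_colorings ((Cup, i) # w) f = num_colorings w (add_pair i True f) + num_colorings w (add_pair i False f)"
| "num_colorings ((Cap, i) # w) f = (if f i = f (Suc i) then num_colorings w (drop_pair i f) else 0)"
| "num_colorings ((X c, i) # w) f = num_colorings w (f \<circ> exchange i)"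

lemma Suc_Suc_diff2: "2 \<le> j \<Longrightarrow> Suc (Suc (j - 2)) = j"
  by simp

lemma recolor:
  "drop_pair (Suc i) (add_pair i b f) = f(i := b)"
  "drop_pair i (add_pair (Suc i) b f) = f(i := b)"
  "add_pair i b f \<circ> exchange i = add_pair i b f"
  "f \<circ> exchange i \<circ> exchange i = f"
  "add_pair i b f \<circ> exchange (Suc i) = add_pair (Suc i) b f \<circ> exchange i"
  "f \<circ> exchange i \<circ> exchange (Suc i) \<circ> exchange i = f \<circ> exchange (Suc i) \<circ> exchange i \<circ> exchange (Suc i)"
  by (auto simp: fun_eq_iff add_pair_def drop_pair_def exchange_def Suc_Suc_diff2)

lemma drop_pair_sw: "f i = f (Suc i) \<Longrightarrow> drop_pair i (f \<circ> exchange i) = drop_pair i f"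
  by (auto simp: fun_eq_iff drop_pair_def exchange_def)

lemma drop_pair_sw_Suc: "drop_pair i (f \<circ> exchange (Suc i)) = drop_pair (Suc i) (f \<circ> exchange i)"
  by (auto simp: fun_eq_iff drop_pair_def exchange_def)

lemma recolor_far:
  "add_pair (i + k + 2) b (add_pair i a f) = add_pair i a (add_pair (i + k) b f)"
  "drop_pair (i + k) (drop_pair i f) = drop_pair i (drop_pair (i + 2 + k) f)"
  "add_pair (i + k) b (drop_pair i f) = drop_pair i (add_pair (i + 2 + k) b f)"
  "drop_pair (i + 2 + k) (add_pair i b f) = add_pair i b (drop_pair (i + k) f)"
  "add_pair i b f \<circ> exchange (i + 2 + k) = add_pair i b (f \<circ> exchange (i + k))"
  "drop_pair i f \<circ> exchange (i + k) = drop_pair i (f \<circ> exchange (i + 2 + k))"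
  "add_pair (i + 2 + k) b (f \<circ> exchange i) = add_pair (i + 2 + k) b f \<circ> exchange i"
  "drop_pair (i + 2 + k) (f \<circ> exchange i) = drop_pair (i + 2 + k) f \<circ> exchange i"
  "f \<circ> exchange i \<circ> exchange (i + 2 + k) = f \<circ> exchange (i + 2 + k) \<circ> exchange i"
  by (auto simp: fun_eq_iff add_pair_def drop_pair_def exchange_def Suc_Suc_diff2)

lemma drop_pair_at: "drop_pair i f (i + k) = f (i + 2 + k)" "drop_pair i f (Suc (i + k)) = f (Suc (i + 2 + k))"
  "j < i \<Longrightarrow> drop_pair i f j = f j"
  by (auto simp: drop_pair_def)

lemma num_colorings_isotopy: "isotopy_move l r \<Longrightarrow> num_colorings (l @ v) f = num_colorings (r @ v) f"
proof (induction rule: isotopy_move.induct)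
  case (interchange a i b k)
  have s: "(f \<circ> exchange i) (Suc (Suc (i + k))) = f (Suc (Suc (i + k)))"
     "(f \<circ> exchange i) (Suc (Suc (Suc (i + k)))) = f (Suc (Suc (Suc (i + k))))"
     "(f \<circ> exchange (Suc (Suc (i + k)))) i = f i" "(f \<circ> exchange (Suc (Suc (i + k)))) (Suc i) = f (Suc i)"
     "add_pair (Suc (Suc (i + k))) x f i = f i" "add_pair (Suc (Suc (i + k))) x f (Suc i) = f (Suc i)"
     "drop_pair (Suc (Suc (i + k))) f i = f i" "drop_pair (Suc (Suc (i + k))) f (Suc i) = f (Suc i)"
     "add_pair i x f (Suc (Suc (i + k))) = f (i + k)"
     "add_pair i x f (Suc (Suc (Suc (i + k)))) = f (Suc (i + k))"
    for f :: "nat \<Rightarrow> bool" and x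
    by (auto simp: exchange_def add_pair_def drop_pair_def)
  show ?case
    by (cases a; cases b) (simp_all add: recolor_far[where i = i and k = k, simplified] s drop_pair_at[where i = i, simplified] del: o_apply)
next
  case (zigzag_left i)
  have "f i \<Longrightarrow> f(i := True) = f" "\<not> f i \<Longrightarrow> f(i := False) = f"
    by (auto simp: fun_eq_iff)
  then show ?case by (auto simp: recolor add_pair_def)
next
  case (zigzag_right i)
  have "f i \<Longrightarrow> f(i := True) = f" "\<not> f i \<Longrightarrow> f(i := False) = f"
    by (auto simp: fun_eq_iff)
  then show ?case by (auto simp: recolor add_pair_def)
next
  case (through_cup i c)
  then show ?case by (simp add: recolor)
next
  case (through_cap c i)
  then show ?case by (auto simp: drop_pair_sw_Suc) (auto simp: exchange_def)
qed

lemma num_colorings_reidemeister: "welded_reidemeister_move l r \<Longrightarrow> num_colorings (l @ v) f = num_colorings (r @ v) f"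
proof (induction rule: welded_reidemeister_move.induct)
  case (RI_cap c i)
  then show ?case by (auto simp: drop_pair_sw) (auto simp: exchange_def)
qed (simp_all add: recolor)

lemma num_colorings_twist: "twist_move l r \<Longrightarrow> num_colorings (l @ v) f = num_colorings (r @ v) f"
  by (induction rule: twist_move.induct) (simp add: recolor)

lemma num_colorings_append: "(\<And>f. num_colorings v f = num_colorings v' f) \<Longrightarrow> num_colorings (u @ v) f = num_colorings (u @ v') f"
  by (induction u f rule: num_colorings.induct) auto

lemma num_colorings_move_step:
  assumes "move_step w w'"
  shows "num_colorings w f = num_colorings w' f"
proof -
  obtain u v l r where "any_move l r \<or> any_move r l" "w = u @ l @ v" "w' = u @ r @ v"
    using assms unfolding move_step_def by blast
  then show ?thesis
    using num_colorings_append[of "l @ v" "r @ v" u f]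
    by (metis any_move_def num_colorings_isotopy num_colorings_reidemeister num_colorings_twist)
qed

lift_definition colorings :: "upper \<Rightarrow> (nat \<Rightarrow> bool) \<Rightarrow> nat" is num_colorings
proof
  fix w w' f
  assume "move_equiv w w'"
  then have "move_step\<^sup>*\<^sup>* w w'" by (simp add: move_equiv_def)
  then show "num_colorings w f = num_colorings w' f" by induction (auto simp: num_colorings_move_step)
qed

lemma colorings_abs: "valid w \<Longrightarrow> colorings (abs_upper w) = num_colorings w"
  by (simp add: colorings.abs_eq move_equiv_refl)

lemma colorings_void [simp]: "colorings void f = 1"
  by transfer simp

lemma colorings_cup:
  "Suc i < width z \<Longrightarrow> colorings (cup i z) f = colorings z (add_pair i True f) + colorings z (add_pair i False f)"
  by transfer simp

lemma colorings_cap: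
  "i \<le> width z \<Longrightarrow> colorings (cap i z) f = (if f i = f (Suc i) then colorings z (drop_pair i f) else 0)"
  by transfer simp

lemma colorings_cross: "Suc i < width z \<Longrightarrow> colorings (cross c i z) f = colorings z (f \<circ> exchange i)"
  by transfer simp

text \<open>
  The colorings themselves, each recorded as the list of the colors chosen at the minima. They connect
  the recursive count with the arcs of the curve.
\<close>

fun coloring_bits :: "slice list \<Rightarrow> (nat \<Rightarrow> bool) \<Rightarrow> bool list set" where
  "coloring_bits [] f = {[]}"
| "coloring_bits ((Cup, i) # w) f = (#) True ` coloring_bits w (add_pair i True f) \<union> (#) False ` coloring_bits w (add_pair i False f)"
| "coloring_bits ((Cap, i) # w) f = (if f i = f (Suc i) then coloring_bits w (drop_pair i f) else {})"
| "coloring_bits ((X c, i) # w) f = coloring_bits w (f \<circ> exchange i)"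

lemma finite_coloring_bits: "finite (coloring_bits w f)"
  by (induction w f rule: coloring_bits.induct) (auto simp: o_def)

lemma card_coloring_bits: "card (coloring_bits w f) = num_colorings w f"
proof (induction w f rule: coloring_bits.induct)
  case (2 i w f)
  then show ?case by (simp, subst card_Un_disjoint) (auto simp: finite_coloring_bits card_image)
qed (auto simp: o_def)

lemma coloring_bits_length: "bs \<in> coloring_bits w f \<Longrightarrow> length bs = length (filter (\<lambda>s. fst s = Cup) w)"
  by (induction w f arbitrary: bs rule: coloring_bits.induct) (auto split: if_splits)

lemma arcs_above: "(p, q) \<in> arcs k n w \<Longrightarrow> k \<le> fst p \<and> k \<le> fst q"
proof (induction w arbitrary: k n)
  case (Cons s w)
  obtain e i where s: "s = (e, i)" by force
  then show ?case using Cons by (cases e) (fastforce simp: vertical_arcs_def)+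
qed simp

text \<open>
  The choices determine the colors on one horizontal line after the other. The resulting function \<open>\<phi>\<close>
  is constant along arcs, and each choice is the color of a point just above a minimum.
\<close>

lemma coloring_bits_coloring:
  "bs \<in> coloring_bits w f \<Longrightarrow> \<exists>\<phi> :: nat \<times> nat \<Rightarrow> bool. (\<forall>j. \<phi> (k, j) = f j) \<and>
     (\<forall>p q. (p, q) \<in> arcs k n w \<longrightarrow> \<phi> p = \<phi> q) \<and> set bs \<subseteq> \<phi> ` (Field (arcs k n w) \<inter> {p. k < fst p})"
proof (induction w arbitrary: k n f bs)
  case Nil
  then show ?case by (auto intro!: exI[of _ "\<lambda>p. f (snd p)"])
next
  case (Cons s w)
  obtain e i where s: "s = (e, i)" by force
  let ?n = "n - ins e + outs e"
  have main: ?case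
    if g: "bs' \<in> coloring_bits w g" "set bs \<subseteq> insert (g i) (set bs')"
      "e \<noteq> Cup \<Longrightarrow> set bs \<subseteq> set bs'"
      "\<And>p q. (p, q) \<in> piece_arcs k (e, i) \<union> vertical_arcs k n (e, i) \<Longrightarrow>
        (if fst p = k then f (snd p) else g (snd p)) = (if fst q = k then f (snd q) else g (snd q))"
    for bs' g
  proof -
    obtain \<psi> :: "nat \<times> nat \<Rightarrow> bool" where \<psi>: "\<And>j. \<psi> (Suc k, j) = g j"
      "\<And>p q. (p, q) \<in> arcs (Suc k) ?n w \<Longrightarrow> \<psi> p = \<psi> q"
      "set bs' \<subseteq> \<psi> ` (Field (arcs (Suc k) ?n w) \<inter> {p. Suc k < fst p})"
      using Cons.IH[OF g(1), of "Suc k" ?n] by (elim exE conjE) blast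
    define \<phi> where "\<phi> p = (if fst p = k then f (snd p) else \<psi> p)" for p
    have lev: "fst p \<in> {k, Suc k} \<and> fst q \<in> {k, Suc k}"
      if "(p, q) \<in> piece_arcs k (e, i) \<union> vertical_arcs k n (e, i)" for p q
      using that by (cases e) (auto simp: vertical_arcs_def)
    have "\<phi> p = \<phi> q" if "(p, q) \<in> arcs k n (s # w)" for p q
    proof (cases "(p, q) \<in> arcs (Suc k) ?n w")
      case True
      then show ?thesis using \<psi>(2)[OF True] arcs_above[OF True] by (simp add: \<phi>_def)
    next
      case False
      then have pq: "(p, q) \<in> piece_arcs k (e, i) \<union> vertical_arcs k n (e, i)"
        using that s by auto
      have "\<phi> r = (if fst r = k then f (snd r) else g (snd r))" if "fst r \<in> {k, Suc k}" for r
        using that \<psi>(1) by (cases r) (auto simp: \<phi>_def)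
      then show ?thesis using g(4)[OF pq] lev[OF pq] by simp
    qed
    moreover have "set bs \<subseteq> \<phi> ` (Field (arcs k n (s # w)) \<inter> {p. k < fst p})"
    proof
      fix b assume b: "b \<in> set bs"
      show "b \<in> \<phi> ` (Field (arcs k n (s # w)) \<inter> {p. k < fst p})"
      proof (cases "b \<in> set bs'")
        case True
        then obtain p where "p \<in> Field (arcs (Suc k) ?n w)" "Suc k < fst p" "b = \<psi> p"
          using \<psi>(3) by blast
        then have "p \<in> Field (arcs k n (s # w))" "k < fst p" "b = \<phi> p"
          by (auto simp: s \<phi>_def Field_def)
        then show ?thesis by blast
      next
        case False
        then have e: "e = Cup" "b = g i" using g(2,3) b by blast+
        then have "b = \<phi> (Suc k, i)" "(Suc k, i) \<in> Field (arcs k n (s # w))"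
          using \<psi>(1) by (auto simp: \<phi>_def s Field_def)
        then show ?thesis by force
      qed
    qed
    ultimately show ?thesis
      by (intro exI[of _ \<phi>]) (auto simp: \<phi>_def)
  qed
  show ?case
  proof (cases e)
    case Cup
    then obtain b bs' where b: "bs = b # bs'" "bs' \<in> coloring_bits w (add_pair i b f)"
      using Cons.prems s by auto
    show ?thesis
      by (rule main[OF b(2)]) (use b Cup in \<open>auto simp: add_pair_def vertical_arcs_def\<close>)
  next
    case Cap
    then have "f i = f (Suc i)" "bs \<in> coloring_bits w (drop_pair i f)"
      using Cons.prems s by (auto split: if_splits)
    then show ?thesis
      by (intro main[of bs "drop_pair i f"]) (use Cap in \<open>auto simp: drop_pair_def vertical_arcs_def Suc_Suc_diff2\<close>)
  next
    case (X c)
    then have "bs \<in> coloring_bits w (f \<circ> exchange i)"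
      using Cons.prems s by (auto split: if_splits)
    then show ?thesis
      by (intro main[of bs "f \<circ> exchange i"]) (use X in \<open>auto simp: exchange_def vertical_arcs_def Suc_Suc_diff2\<close>)
  qed
qed

text \<open>
  On a connected curve a coloring is constant, so all its choices agree.
\<close>

lemma num_colorings_one_circle:
  assumes "one_circle w"
  shows "num_colorings w f \<le> 2"
proof -
  define m where "m = length (filter (\<lambda>s. fst s = Cup) w)"
  have "bs \<in> {replicate m True, replicate m False}" if bs: "bs \<in> coloring_bits w f" for bs
  proof -
    obtain \<phi> :: "nat \<times> nat \<Rightarrow> bool" where \<phi>:
      "\<And>p q. (p, q) \<in> arcs 0 0 w \<Longrightarrow> \<phi> p = \<phi> q" "set bs \<subseteq> \<phi> ` (Field (arcs 0 0 w) \<inter> {p. 0 < fst p})"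
      using coloring_bits_coloring[OF bs, of 0 0] by (elim exE conjE) blast
    have "\<phi> p = \<phi> q" if "(p, q) \<in> (arcs 0 0 w \<union> (arcs 0 0 w)\<inverse>)\<^sup>*" for p q
      using that
    proof induction
      case (step y z)
      then have "\<phi> y = \<phi> z" using \<phi>(1)[of y z] \<phi>(1)[of z y] by blast
      with step.IH show ?case by simp
    qed simp
    then have const: "\<phi> p = \<phi> q" if "p \<in> Field (arcs 0 0 w)" "q \<in> Field (arcs 0 0 w)" for p q
      using assms that unfolding one_circle_def Let_def by blast
    obtain q where q: "q \<in> Field (arcs 0 0 w)"
      using assms unfolding one_circle_def Let_def by blast
    have "\<phi> ` (Field (arcs 0 0 w) \<inter> {p. 0 < fst p}) \<subseteq> {\<phi> q}"
    proof (rule image_subsetI)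
      fix p assume "p \<in> Field (arcs 0 0 w) \<inter> {p. 0 < fst p}"
      then have "\<phi> p = \<phi> q" using const[OF _ q] by blast
      then show "\<phi> p \<in> {\<phi> q}" by (rule ssubst) (rule singletonI)
    qed
    then have "set bs \<subseteq> {\<phi> q}" using \<phi>(2) by (rule subset_trans[rotated])
    then have "\<forall>x\<in>set bs. x = \<phi> q" by blast
    then have "bs = replicate m (\<phi> q)"
      using coloring_bits_length[OF bs] replicate_length_same[of bs] unfolding m_def by simp
    then show ?thesis by (cases "\<phi> q") auto
  qed
  then have "card (coloring_bits w f) \<le> card {replicate m True, replicate m False}"
    by (intro card_mono) auto
  also have "\<dots> \<le> 2" by (simp add: card_insert_if)
  finally show ?thesis by (simp add: card_coloring_bits)
qed

section \<open>Plat form\<close>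

definition cups :: "nat \<Rightarrow> upper \<Rightarrow> upper" where
  "cups n = cup 0 ^^ n"

definition caps :: "nat \<Rightarrow> upper" where
  "caps n = (cap 0 ^^ n) void"

lemma cups_0 [simp]: "cups 0 z = z" and cups_Suc: "cups (Suc n) z = cup 0 (cups n z)"
  by (simp_all add: cups_def)

lemma cups_Suc': "cups (Suc n) z = cups n (cup 0 z)"
  by (simp add: cups_def funpow_swap1)

lemma caps_0 [simp]: "caps 0 = void" and caps_Suc: "caps (Suc n) = cap 0 (caps n)"
  by (simp_all add: caps_def)

lemma width_cups [simp]: "2 * n \<le> width z \<Longrightarrow> width (cups n z) = width z - 2 * n"
  by (induction n) (auto simp: cups_Suc)

lemma width_caps [simp]: "width (caps n) = 2 * n"
  by (induction n) (auto simp: caps_Suc)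

fun braid :: "(crossing \<times> nat) list \<Rightarrow> upper \<Rightarrow> upper" where
  "braid [] z = z"
| "braid ((c, i) # bs) z = cross c i (braid bs z)"

definition fits :: "nat \<Rightarrow> (crossing \<times> nat) list \<Rightarrow> bool" where
  "fits n bs \<longleftrightarrow> (\<forall>(c, i)\<in>set bs. Suc i < n)"

lemma fits_simps [simp]:
  "fits n []" "fits n ((c, i) # bs) \<longleftrightarrow> Suc i < n \<and> fits n bs"
  "fits n (bs @ bs') \<longleftrightarrow> fits n bs \<and> fits n bs'"
  by (auto simp: fits_def)

lemma fits_mono: "fits n bs \<Longrightarrow> n \<le> m \<Longrightarrow> fits m bs"
  by (fastforce simp: fits_def)

lemma braid_append [simp]: "braid (bs @ bs') z = braid bs (braid bs' z)"
  by (induction bs z rule: braid.induct) auto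

lemma width_braid [simp]: "width (braid bs z) = width z"
  by (induction bs z rule: braid.induct) auto

definition shift :: "nat \<Rightarrow> (crossing \<times> nat) list \<Rightarrow> (crossing \<times> nat) list" where
  "shift k = map (\<lambda>(c, i). (c, i + k))"

lemma shift_simps [simp]: "shift k [] = []" "shift k ((c, i) # bs) = (c, i + k) # shift k bs"
  by (simp_all add: shift_def)

lemma fits_shift [simp]: "fits (n + k) (shift k bs) \<longleftrightarrow> fits n bs"
  by (auto simp: fits_def shift_def)

lemma braid_cups:
  "fits n bs \<Longrightarrow> n + 2 * a \<le> width z \<Longrightarrow> braid bs (cups a z) = cups a (braid (shift (2 * a) bs) z)"
proof (induction bs)
  case (Cons x bs)
  obtain c i where x: "x = (c, i)" by force
  have "cross c i (cups a y) = cups a (cross c (i + 2 * a) y)" if "Suc i + 2 * a < width y" for y i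
    using that
  proof (induction a arbitrary: i)
    case (Suc a)
    then have "cross c i (cups (Suc a) y) = cup 0 (cross c (Suc (Suc i)) (cups a y))"
      using cup_cross[of 0 "Suc (Suc i)" "cups a y" c] by (simp add: cups_Suc)
    then show ?case using Suc.IH[of "Suc (Suc i)"] Suc.prems by (simp add: cups_Suc)
  qed simp
  then show ?case using Cons x by simp
qed simp

lemma cap_cups:
  "i + 2 * a \<le> width z \<Longrightarrow> cap i (cups a z) = cups a (cap (i + 2 * a) z)"
proof (induction a arbitrary: i)
  case (Suc a)
  then have "cap i (cups (Suc a) z) = cup 0 (cap (Suc (Suc i)) (cups a z))"
    using put_interchange[of 0 Cup i Cap "cups a z"] by (simp add: cups_Suc)
  then show ?case using Suc.IH[of "Suc (Suc i)"] Suc.prems by (simp add: cups_Suc)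
qed simp

lemma cap_braid:
  "fits (width z) bs \<Longrightarrow> cap 0 (braid bs z) = braid (shift 2 bs) (cap 0 z)"
proof (induction bs)
  case (Cons x bs)
  then show ?case using cross_cap[of 0 "snd x" "braid bs z" "fst x"] by (cases x) simp
qed simp

lemma cup_to_left:
  "Suc i < width z \<Longrightarrow> \<exists>bs. fits (width z) bs \<and> cup i z = cup 0 (braid bs z)"
proof (induction i arbitrary: z)
  case 0
  show ?case by (rule exI[of _ "[]"]) simp
next
  case (Suc i)
  then obtain bs where "fits (width z) bs"
    "cup i (cross Weld (Suc i) (cross Weld i z)) = cup 0 (braid bs (cross Weld (Suc i) (cross Weld i z)))"
    using Suc.IH[of "cross Weld (Suc i) (cross Weld i z)"] by auto
  then show ?case using Suc.prems
    by (intro exI[of _ "bs @ [(Weld, Suc i), (Weld, i)]"]) (simp add: cup_Suc)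
qed

lemma cap_to_left:
  "i \<le> width z \<Longrightarrow> \<exists>bs. fits (width z + 2) bs \<and> cap i z = braid bs (cap 0 z)"
proof (induction i)
  case 0
  show ?case by (rule exI[of _ "[]"]) simp
next
  case (Suc i)
  then obtain bs where "fits (width z + 2) bs" "cap i z = braid bs (cap 0 z)"
    using Suc by auto
  then show ?case using Suc.prems
    by (intro exI[of _ "(Weld, i) # (Weld, Suc i) # bs"]) (simp add: cap_Suc)
qed

text \<open>
  Adding slices at the bottom one by one: a crossing moves up past the minima; a new minimum is moved
  to the far left, at the price of welded crossings; a new maximum moves up past the minima, then to
  the far left, and past the crossings.
\<close>

lemma plat_form:
  "\<exists>a b bs. width z + 2 * a = 2 * b \<and> fits (2 * b) bs \<and> z = cups a (braid bs (caps b))"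
proof (induction z rule: upper_induct)
  case void
  show ?case by (intro exI[of _ 0] exI[of _ "[]"]) simp
next
  case (put e i z)
  then obtain a b bs where z: "width z + 2 * a = 2 * b" "fits (2 * b) bs"
    "z = cups a (braid bs (caps b))" by blast
  show ?case
  proof (cases e)
    case Cup
    with put.hyps have i: "Suc i < width z" by simp
    then obtain ws where ws: "fits (width z) ws" "cup i z = cup 0 (braid ws z)"
      using cup_to_left by blast
    have "braid ws z = cups a (braid (shift (2 * a) ws @ bs) (caps b))"
      using ws(1) z by (subst z(3)) (simp add: braid_cups[of "width z"])
    moreover have "fits (2 * b) (shift (2 * a) ws)" using ws(1) z(1) fits_shift by metis
    ultimately show ?thesis using z i ws Cup
      by (intro exI[of _ "Suc a"] exI[of _ b] exI[of _ "shift (2 * a) ws @ bs"])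
        (auto simp: cups_Suc)
  next
    case Cap
    with put.hyps have i: "i \<le> width z" by simp
    let ?y = "braid bs (caps b)"
    obtain ws where ws: "fits (2 * b + 2) ws" "cap (i + 2 * a) ?y = braid ws (cap 0 ?y)"
      using cap_to_left[of "i + 2 * a" ?y] i z(1) by auto
    have "cap i z = cups a (cap (i + 2 * a) ?y)"
      using i z(1) by (subst z(3)) (simp add: cap_cups)
    also have "\<dots> = cups a (braid (ws @ shift 2 bs) (caps (Suc b)))"
      using z ws by (simp add: cap_braid caps_Suc)
    finally show ?thesis using z i ws Cap
      by (intro exI[of _ a] exI[of _ "Suc b"] exI[of _ "ws @ shift 2 bs"])
        (auto simp flip: fits_shift[of "2 * b" 2] intro: fits_mono)
  next
    case (X c)
    with put.hyps have i: "Suc i < width z" by simp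
    have "cross c i z = cups a (braid (shift (2 * a) [(c, i)] @ bs) (caps b))"
      using i z(1) braid_cups[of "width z" "[(c, i)]" a "braid bs (caps b)"] by (subst z(3)) simp
    then show ?thesis using z i X
      by (intro exI[of _ a] exI[of _ b] exI[of _ "(c, i + 2 * a) # bs"]) auto
  qed
qed

text \<open>
  Minima side by side can be reordered, so each of them may be regarded as the topmost one, and each
  maximum as the lowest one.
\<close>

lemma cups_pair: "m \<le> n \<Longrightarrow> 2 * n + 2 \<le> width z \<Longrightarrow> cups (Suc n) z = cups n (cup (2 * m) z)"
proof (induction n arbitrary: m z)
  case 0
  then show ?case by (simp add: cups_Suc)
next
  case (Suc n)
  show ?case
  proof (cases m)
    case 0
    then show ?thesis by (simp add: cups_Suc')
  next
    case (Suc k)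
    have "cups (Suc (Suc n)) z = cups n (cup (2 * k) (cup 0 z))"
      using Suc.IH[of k "cup 0 z"] Suc.prems Suc by (simp add: cups_Suc'[of "Suc n"])
    also have "cup (2 * k) (cup 0 z) = cup 0 (cup (2 * m) z)"
      using put_interchange[of 0 Cup "2 * k" Cup z] Suc.prems Suc by simp
    finally show ?thesis by (simp add: cups_Suc')
  qed
qed

lemma caps_pair: "m \<le> n \<Longrightarrow> caps (Suc n) = cap (2 * m) (caps n)"
proof (induction n arbitrary: m)
  case 0
  then show ?case by (simp add: caps_Suc)
next
  case (Suc n)
  show ?case
  proof (cases m)
    case 0
    then show ?thesis by (simp add: caps_Suc)
  next
    case (Suc k)
    have "caps (Suc (Suc n)) = cap 0 (cap (2 * k) (caps n))"
      using Suc.IH[of k] Suc.prems Suc by (simp add: caps_Suc)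
    also have "\<dots> = cap (2 * m) (caps (Suc n))"
      using put_interchange[of 0 Cap "2 * k" Cap "caps n"] Suc.prems Suc by (simp add: caps_Suc)
    finally show ?thesis .
  qed
qed

text \<open>
  The permutation of the strands is read from the top down, because in this direction it composes with
  a coloring of the strands at the bottom.
\<close>

fun bottom_of :: "(crossing \<times> nat) list \<Rightarrow> nat \<Rightarrow> nat" where
  "bottom_of [] s = s"
| "bottom_of ((c, i) # bs) s = exchange i (bottom_of bs s)"

lemma bottom_of_append [simp]: "bottom_of (bs @ bs') s = bottom_of bs (bottom_of bs' s)"
  by (induction bs s rule: bottom_of.induct) auto

lemma bottom_of_eq_iff [simp]: "bottom_of bs s = bottom_of bs t \<longleftrightarrow> s = t"
  by (induction bs s rule: bottom_of.induct) auto

lemma bottom_of_less: "fits n bs \<Longrightarrow> s < n \<Longrightarrow> bottom_of bs s < n"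
  by (induction bs s rule: bottom_of.induct) (auto simp: exchange_less)

lemma bottom_of_surj:
  assumes "fits n bs" "a < n"
  obtains s where "s < n" "a = bottom_of bs s"
proof -
  have "bottom_of bs ` {..<n} \<subseteq> {..<n}" using assms by (auto simp: bottom_of_less)
  moreover have "inj_on (bottom_of bs) {..<n}" by (simp add: inj_on_def)
  ultimately have "bottom_of bs ` {..<n} = {..<n}"
    by (simp add: card_image card_subset_eq)
  then show ?thesis using assms that by blast
qed

lemma braid_chord:
  "c \<noteq> Weld \<Longrightarrow> fits (width z) bs \<Longrightarrow> s \<noteq> t \<Longrightarrow> s < width z \<Longrightarrow> t < width z \<Longrightarrow>
    braid bs (chord s t c z) = chord (bottom_of bs s) (bottom_of bs t) c (braid bs z)"
proof (induction bs)
  case (Cons x bs)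
  then show ?case by (cases x) (simp add: chord_cross bottom_of_less exchange_less)
qed simp

lemma colorings_braid:
  "fits (width z) bs \<Longrightarrow> colorings (braid bs z) f = colorings z (f \<circ> bottom_of bs)"
proof (induction bs arbitrary: f)
  case Nil
  have "f \<circ> bottom_of [] = f" by (simp add: fun_eq_iff)
  then show ?case by simp
next
  case (Cons x bs)
  obtain c i where x: "x = (c, i)" by force
  have "f \<circ> exchange i \<circ> bottom_of bs = f \<circ> bottom_of (x # bs)" by (simp add: fun_eq_iff x)
  then show ?case using Cons x by (simp add: colorings_cross)
qed

definition paired :: "nat \<Rightarrow> (nat \<Rightarrow> bool) \<Rightarrow> bool" where
  "paired n f \<longleftrightarrow> (\<forall>m<n. f (2 * m) = f (Suc (2 * m)))"

lemma colorings_caps: "colorings (caps n) f = (if paired n f then 1 else 0)"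
proof (induction n arbitrary: f)
  case 0
  then show ?case by (simp add: paired_def)
next
  case (Suc n)
  have "paired (Suc n) f \<longleftrightarrow> f 0 = f (Suc 0) \<and> paired n (drop_pair 0 f)"
    unfolding paired_def drop_pair_def by (subst All_less_Suc2) simp
  then show ?case by (simp add: caps_Suc colorings_cap Suc.IH)
qed

text \<open>
  Each coloring \<open>g\<close> above the minima that is constant on their legs extends downwards in exactly one
  way, so distinct \<open>g\<close> contribute separately to the count.
\<close>

lemma colorings_cups_ge:
  assumes "finite S" "2 * n \<le> width z" "\<And>g. g \<in> S \<Longrightarrow> paired n g \<and> (\<forall>j. g (j + 2 * n) = f j)"
  shows "(\<Sum>g\<in>S. colorings z g) \<le> colorings (cups n z) f"
  using assms
proof (induction n arbitrary: f S)
  case 0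
  then have "S \<subseteq> {f}" by (auto simp: fun_eq_iff)
  then have "S = {} \<or> S = {f}" by blast
  then show ?case by auto
next
  case (Suc n)
  let ?S = "\<lambda>b. {g \<in> S. g (2 * n) = b}"
  have "(\<Sum>g\<in>?S b. colorings z g) \<le> colorings (cups n z) (add_pair 0 b f)" for b
  proof (rule Suc.IH)
    fix g assume "g \<in> ?S b"
    then have g: "g (2 * n) = b" "paired (Suc n) g" "\<And>j. g (j + 2 * Suc n) = f j"
      using Suc.prems by auto
    have "g (j + 2 * n) = add_pair 0 b f j" for j
    proof -
      consider "j = 0" | "j = 1" | "j \<ge> 2" by linarith
      then show ?thesis
      proof cases
        case 3
        then obtain k where "j = Suc (Suc k)" by (metis Suc_Suc_diff2)
        then show ?thesis using g(3)[of k] by (simp add: add_pair_def)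
      qed (use g(1,2) in \<open>auto simp: add_pair_def paired_def\<close>)
    qed
    then show "paired n g \<and> (\<forall>j. g (j + 2 * n) = add_pair 0 b f j)"
      using g(2) by (simp add: paired_def)
  qed (use Suc.prems in auto)
  note le = this
  have "S = ?S True \<union> ?S False" by blast
  then have "(\<Sum>g\<in>S. colorings z g) = (\<Sum>g\<in>?S True. colorings z g) + (\<Sum>g\<in>?S False. colorings z g)"
    using Suc.prems(1) by (subst sum.union_disjoint[symmetric]) auto
  also have "\<dots> \<le> colorings (cups (Suc n) z) f"
    using le[of True] le[of False] Suc.prems by (simp add: cups_Suc colorings_cup)
  finally show ?case .
qed

section \<open>Removing the classical crossings\<close>

text \<open>
  For a nonempty closed diagram this says that the curve is one circle. Being stated for classes of
  diagrams, it is preserved by moves.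
\<close>

definition rigid :: "upper \<Rightarrow> bool" where
  "rigid z \<longleftrightarrow> colorings z (\<lambda>_. False) \<le> 2"

lemma colorings_plat_ge:
  assumes "fits (2 * n) bs" "finite S"
    and "\<And>g. g \<in> S \<Longrightarrow> paired n g \<and> paired n (g \<circ> bottom_of bs) \<and> (\<forall>j\<ge>2 * n. \<not> g j)"
  shows "card S \<le> colorings (cups n (braid bs (caps n))) (\<lambda>_. False)"
proof -
  have "card S = (\<Sum>g\<in>S. colorings (braid bs (caps n)) g)"
    using assms by (simp add: colorings_braid colorings_caps)
  also have "\<dots> \<le> colorings (cups n (braid bs (caps n))) (\<lambda>_. False)"
  proof (rule colorings_cups_ge)
    fix g assume "g \<in> S"
    then show "paired n g \<and> (\<forall>j. g (j + 2 * n) = False)" using assms(3)[of g] by auto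
  qed (use assms in auto)
  finally show ?thesis .
qed

lemma colorings_plat_ge_2:
  assumes "fits (2 * n) bs" "0 < n"
  shows "2 \<le> colorings (cups n (braid bs (caps n))) (\<lambda>_. False)"
proof -
  let ?g = "\<lambda>b j. b \<and> j < 2 * n"
  have "?g True 0 \<noteq> ?g False 0" using assms by simp
  then have "?g True \<noteq> ?g False" by metis
  then have "card {?g True, ?g False} = 2" by simp
  moreover have "card {?g True, ?g False} \<le> colorings (cups n (braid bs (caps n))) (\<lambda>_. False)"
    using assms by (intro colorings_plat_ge) (auto simp: paired_def bottom_of_less)
  ultimately show ?thesis by simp
qed

text \<open>
  A set of strands that is closed under passing to the other leg of each minimum and of each maximum
  is a union of circles. If it were neither empty nor everything, its characteristic function
  would be a third coloring besides the two constant ones.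
\<close>

lemma rigid_invariant_set:
  assumes rigid: "rigid (cups n (braid bs (caps n)))" and fits: "fits (2 * n) bs"
    and K: "\<And>m. m < n \<Longrightarrow> 2 * m \<in> K \<longleftrightarrow> Suc (2 * m) \<in> K"
      "\<And>m. m < n \<Longrightarrow> bottom_of bs (2 * m) \<in> K \<longleftrightarrow> bottom_of bs (Suc (2 * m)) \<in> K"
    and "b \<in> K" "b < 2 * n" "a < 2 * n"
  shows "a \<in> K"
proof (rule ccontr)
  assume "a \<notin> K"
  define g where "g L j \<longleftrightarrow> j \<in> L \<and> j < 2 * n" for L and j :: nat
  have g: "g K b" "\<not> g K a" "g UNIV a" "g UNIV b" "\<not> g {} a" "\<not> g {} b"
    using assms \<open>a \<notin> K\<close> by (auto simp: g_def)
  then have "g K \<noteq> g UNIV" "g K \<noteq> g {}" "g UNIV \<noteq> g {}" by metis+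
  then have "card {g K, g UNIV, g {}} = 3" by simp
  moreover have "card {g K, g UNIV, g {}} \<le> colorings (cups n (braid bs (caps n))) (\<lambda>_. False)"
    using K fits by (intro colorings_plat_ge) (auto simp: paired_def bottom_of_less g_def)
  ultimately show False using rigid by (simp add: rigid_def)
qed

text \<open>
  The common pattern of a minimum and of a maximum with legs \<open>s\<close> and \<open>t\<close>. Here \<open>Q a c\<close> stands for a
  diagram with a chord from \<open>a\<close> to a fixed strand \<open>b\<close>, and \<open>y\<close> for the diagram without it; the
  ends of a chord are on different strands, which accounts for the alternative \<open>a = b\<close>.
\<close>

lemma slide_to_partner:
  fixes Q :: "nat \<Rightarrow> crossing \<Rightarrow> 'a"
  assumes "b = s \<Longrightarrow> \<forall>c. c \<noteq> Weld \<longrightarrow> Q t c = y" "b = t \<Longrightarrow> \<forall>c. c \<noteq> Weld \<longrightarrow> Q s c = y"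
    and "\<And>c. c \<noteq> Weld \<Longrightarrow> b \<noteq> s \<Longrightarrow> b \<noteq> t \<Longrightarrow> Q s c = Q t (flip c)"
  shows "(s = b \<or> (\<forall>c. c \<noteq> Weld \<longrightarrow> Q s c = y)) \<longleftrightarrow> (t = b \<or> (\<forall>c. c \<noteq> Weld \<longrightarrow> Q t c = y))"
proof -
  have c: "flip c \<noteq> Weld" "flip (flip c) = c" if "c \<noteq> Weld" for c
    using that by (cases c; simp)+
  show ?thesis using assms c by metis
qed

lemma cups_chord:
  assumes "m < n" "2 * n \<le> width z"
  shows "cups n (chord (2 * m) (Suc (2 * m)) c z) = cups n z"
    and "c \<noteq> Weld \<Longrightarrow> u \<noteq> 2 * m \<Longrightarrow> u \<noteq> Suc (2 * m) \<Longrightarrow> u < width z \<Longrightarrow>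
      cups n (chord (2 * m) u c z) = cups n (chord (Suc (2 * m)) u (flip c) z)"
proof -
  obtain k where k: "n = Suc k" using assms by (cases n) auto
  have *: "cups n y = cups k (cup (2 * m) y)" if "width y = width z" for y
    using cups_pair[of m k y] assms k that by simp
  show "cups n (chord (2 * m) (Suc (2 * m)) c z) = cups n z"
    using assms by (simp add: * cup_absorbs_chord)
  show "cups n (chord (2 * m) u c z) = cups n (chord (Suc (2 * m)) u (flip c) z)"
    if "c \<noteq> Weld" "u \<noteq> 2 * m" "u \<noteq> Suc (2 * m)" "u < width z"
    using assms that by (simp add: * chord_slides_under_cup[of c "2 * m" z u])
qed

lemma chord_caps:
  assumes "m < n"
  shows "chord (2 * m) (Suc (2 * m)) c (caps n) = caps n"
    and "c \<noteq> Weld \<Longrightarrow> u \<noteq> 2 * m \<Longrightarrow> u \<noteq> Suc (2 * m) \<Longrightarrow> u < 2 * n \<Longrightarrow>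
      chord (2 * m) u c (caps n) = chord (Suc (2 * m)) u (flip c) (caps n)"
proof -
  obtain k where k: "n = Suc k" using assms by (cases n) auto
  have *: "caps n = cap (2 * m) (caps k)"
    using caps_pair[of m k] assms k by simp
  show "chord (2 * m) (Suc (2 * m)) c (caps n) = caps n"
    using assms k cap_absorbs_chord[of "2 * m" "caps k" c] unfolding * by simp
  show "chord (2 * m) u c (caps n) = chord (Suc (2 * m)) u (flip c) (caps n)"
    if "c \<noteq> Weld" "u \<noteq> 2 * m" "u \<noteq> Suc (2 * m)" "u < 2 * n"
    using assms that k chord_slides_over_cap[of c "2 * m" "caps k" u] unfolding * by simp
qed

text \<open>
  Fix the end \<open>b\<close> of the chord and consider the strands \<open>a\<close> from which the chord can be removed,
  together with \<open>b\<close> itself. Sliding the end \<open>a\<close> around a minimum, or through the braid and around a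
  maximum, shows that this set is closed under the passages in \<open>rigid_invariant_set\<close>.
\<close>

lemma chord_removable:
  assumes rigid: "rigid (cups n (braid bs (caps n)))" and fits: "fits (2 * n) bs"
    and ab: "a \<noteq> b" "a < 2 * n" "b < 2 * n" and "c \<noteq> Weld"
  shows "cups n (chord a b c (braid bs (caps n))) = cups n (braid bs (caps n))"
proof -
  let ?z = "braid bs (caps n)"
  define K where "K = {a. a = b \<or> (\<forall>c. c \<noteq> Weld \<longrightarrow> cups n (chord a b c ?z) = cups n ?z)}"
  obtain t where t: "t < 2 * n" "b = bottom_of bs t"
    using bottom_of_surj[OF fits ab(3)] by blast
  have "a \<in> K"
  proof (rule rigid_invariant_set[OF rigid fits, where b = b])
    fix m assume m: "m < n"
    show "2 * m \<in> K \<longleftrightarrow> Suc (2 * m) \<in> K"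
      unfolding K_def mem_Collect_eq
      using m ab cups_chord[of m n ?z] by (intro slide_to_partner) (auto simp: chord_sym[of "Suc (2 * m)"])
    have pull: "chord (bottom_of bs s) b c ?z = braid bs (chord s t c (caps n))"
      if "s \<noteq> t" "s < 2 * n" "c \<noteq> Weld" for s c
      using braid_chord[of c "caps n" bs s t] that t fits by simp
    have "2 * m < 2 * n" "Suc (2 * m) < 2 * n" using m by auto
    then show "bottom_of bs (2 * m) \<in> K \<longleftrightarrow> bottom_of bs (Suc (2 * m)) \<in> K"
      unfolding K_def mem_Collect_eq
    proof (intro slide_to_partner)
      assume l: "2 * m < 2 * n" "Suc (2 * m) < 2 * n"
      { assume "b = bottom_of bs (2 * m)"
        then have "t = 2 * m" using t by simp
        then show "\<forall>c. c \<noteq> Weld \<longrightarrow> cups n (chord (bottom_of bs (Suc (2 * m))) b c ?z) = cups n ?z"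
          using pull[of "Suc (2 * m)"] l chord_caps(1)[OF m]
          by (simp add: chord_sym[of "Suc (2 * m)"]) }
      { assume "b = bottom_of bs (Suc (2 * m))"
        then have "t = Suc (2 * m)" using t by simp
        then show "\<forall>c. c \<noteq> Weld \<longrightarrow> cups n (chord (bottom_of bs (2 * m)) b c ?z) = cups n ?z"
          using pull[of "2 * m"] l chord_caps(1)[OF m] by simp }
      fix c assume c: "c \<noteq> Weld" "b \<noteq> bottom_of bs (2 * m)" "b \<noteq> bottom_of bs (Suc (2 * m))"
      then have "flip c \<noteq> Weld" "t \<noteq> 2 * m" "t \<noteq> Suc (2 * m)" using t by (cases c; simp)+
      then show "cups n (chord (bottom_of bs (2 * m)) b c ?z) =
          cups n (chord (bottom_of bs (Suc (2 * m))) b (flip c) ?z)"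
        using pull[of "2 * m" c] pull[of "Suc (2 * m)" "flip c"] c(1) l t(1) chord_caps(2)[OF m c(1), of t]
        by simp
    qed
  qed (use ab in \<open>auto simp: K_def\<close>)
  then show ?thesis using assms by (simp add: K_def)
qed

text \<open>
  A welded crossing is the classical crossing followed by the chord of opposite sign; this chord is
  pulled down to the minima and removed.
\<close>

lemma weld_crossing:
  assumes "rigid (cups n (braid (ps @ (c, i) # qs) (caps n)))" "fits (2 * n) (ps @ (c, i) # qs)"
  shows "cups n (braid (ps @ (c, i) # qs) (caps n)) = cups n (braid (ps @ (Weld, i) # qs) (caps n))"
proof (cases "c = Weld")
  case c: False
  let ?z = "braid qs (caps n)" and ?ps = "ps @ [(c, i)]"
  have fc: "flip c \<noteq> Weld" using c by (cases c) simp_all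
  have i: "Suc i < width ?z" using assms by simp
  have "cross Weld i ?z = cross c i (chord i (Suc i) (flip c) ?z)"
    using i fc RII[of i "cross Weld i ?z" c] by (simp add: chord_def weld_comm)
  then have "braid (ps @ (Weld, i) # qs) (caps n) = braid ?ps (chord i (Suc i) (flip c) ?z)"
    by simp
  also have "\<dots> = chord (bottom_of ?ps i) (bottom_of ?ps (Suc i)) (flip c) (braid ?ps ?z)"
    using i fc assms(2) by (intro braid_chord) simp_all
  finally have "cups n (braid (ps @ (Weld, i) # qs) (caps n)) =
      cups n (chord (bottom_of ?ps i) (bottom_of ?ps (Suc i)) (flip c) (braid (ps @ (c, i) # qs) (caps n)))"
    by simp
  also have "\<dots> = cups n (braid (ps @ (c, i) # qs) (caps n))"
    using assms i fc by (intro chord_removable) (simp_all add: bottom_of_less del: bottom_of_append)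
  finally show ?thesis by simp
qed simp

definition welds :: "nat list \<Rightarrow> (crossing \<times> nat) list" where
  "welds is = map (Pair Weld) is"

lemma welds_simps [simp]:
  "welds [] = []" "welds (i # is) = (Weld, i) # welds is" "welds (is @ js) = welds is @ welds js"
  by (simp_all add: welds_def)

lemma fits_welds: "fits n (welds is) \<longleftrightarrow> (\<forall>i\<in>set is. Suc i < n)"
  by (auto simp: fits_def welds_def)

lemma weld_all_crossings:
  assumes "rigid (cups n (braid bs (caps n)))" "fits (2 * n) bs"
  shows "cups n (braid bs (caps n)) = cups n (braid (welds (map snd bs)) (caps n))"
proof -
  have "cups n (braid (ps @ qs) (caps n)) = cups n (braid (ps @ welds (map snd qs)) (caps n))"
    if "rigid (cups n (braid (ps @ qs) (caps n)))" "fits (2 * n) (ps @ qs)" for ps qs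
    using that
  proof (induction qs arbitrary: ps)
    case (Cons x qs)
    obtain c i where x: "x = (c, i)" by force
    have "cups n (braid (ps @ x # qs) (caps n)) = cups n (braid ((ps @ [(Weld, i)]) @ qs) (caps n))"
      using weld_crossing[of n ps c i qs] Cons.prems x by simp
    then show ?case using Cons.IH[of "ps @ [(Weld, i)]"] Cons.prems x by simp
  qed simp
  from this[of "[]" bs] assms show ?thesis by simp
qed

section \<open>Reducing welded plats\<close>

abbreviation weld_braid :: "nat list \<Rightarrow> upper \<Rightarrow> upper" where
  "weld_braid is z \<equiv> braid (welds is) z"

lemma weld_braid_far_right:
  "\<forall>j\<in>set is. Suc j < i \<Longrightarrow> Suc i < width z \<Longrightarrow>
    weld_braid is (cross Weld i z) = cross Weld i (weld_braid is z)"
  by (induction "is") (simp_all add: cross_far[of _ i])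

lemma weld_braid_far_left:
  "\<forall>j\<in>set is. Suc i < j \<and> Suc j < width z \<Longrightarrow>
    weld_braid is (cross Weld i z) = cross Weld i (weld_braid is z)"
  by (induction "is") (simp_all add: cross_far[of i, symmetric])

text \<open>
  The welded crossings \<open>k, ..., j - 1\<close> carry strand \<open>k\<close> across to position \<open>j\<close>. The strands that it
  passes shift to the left by one, hence the crossing of two of them is numbered \<open>i\<close> above and \<open>i + 1\<close>
  below.
\<close>

lemma cycle_weld:
  assumes "k \<le> i" "Suc i < j" "j < width z"
  shows "weld_braid [k..<j] (cross Weld i z) = cross Weld (Suc i) (weld_braid [k..<j] z)"
proof -
  have "[k..<j] = [k..<i] @ [i, Suc i] @ [Suc (Suc i)..<j]"
    using assms upt_add_eq_append[of k i "j - i"] by (simp add: upt_conv_Cons)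
  moreover have "weld_braid [Suc (Suc i)..<j] (cross Weld i z) = cross Weld i (weld_braid [Suc (Suc i)..<j] z)"
    using assms by (intro weld_braid_far_left) auto
  moreover have "weld_braid [k..<i] (cross Weld (Suc i) y) = cross Weld (Suc i) (weld_braid [k..<i] y)"
    if "width y = width z" for y
    using assms that by (intro weld_braid_far_right) auto
  ultimately show ?thesis using assms by (simp add: VRIII)
qed

text \<open>
  Coset representatives in the symmetric group: among the strands \<open>k, k + 1, ...\<close> all except strand
  \<open>k\<close> are permuted first, then strand \<open>k\<close> is carried to its place.
\<close>

lemma weld_normal_form:
  assumes "set is \<subseteq> {k..}" "\<forall>i\<in>set is. Suc i < width z" "k < width z"
  shows "\<exists>js j. set js \<subseteq> {Suc k..} \<and> (\<forall>i\<in>set js. Suc i < width z) \<and> k \<le> j \<and> j < width z \<and>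
    weld_braid is z = weld_braid js (weld_braid [k..<j] z)"
  using assms
proof (induction "is" arbitrary: z rule: rev_induct)
  case Nil
  then show ?case by (intro exI[of _ "[]"] exI[of _ k]) simp
next
  case (snoc i "is")
  then obtain js j where js: "set js \<subseteq> {Suc k..}" "\<forall>i\<in>set js. Suc i < width z" "k \<le> j" "j < width z"
    "weld_braid is (cross Weld i z) = weld_braid js (weld_braid [k..<j] (cross Weld i z))"
    using snoc.IH[of "cross Weld i z"] by auto
  have i: "k \<le> i" "Suc i < width z" using snoc.prems by auto
  consider "j < i" | "j = i" | "j = Suc i" | "Suc i < j" by linarith
  then show ?case
  proof cases
    case 1
    then have "weld_braid [k..<j] (cross Weld i z) = cross Weld i (weld_braid [k..<j] z)"
      using i by (intro weld_braid_far_right) auto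
    then show ?thesis using js i 1 by (intro exI[of _ "js @ [i]"] exI[of _ j]) auto
  next
    case 2
    then show ?thesis using js i by (intro exI[of _ js] exI[of _ "Suc i"]) auto
  next
    case 3
    then show ?thesis using js i by (intro exI[of _ js] exI[of _ i]) auto
  next
    case 4
    then show ?thesis using js i cycle_weld[of k i j z]
      by (intro exI[of _ "js @ [Suc i]"] exI[of _ j]) auto
  qed
qed

text \<open>
  Both sides are two nested maxima, because by \<open>through_cap\<close> either of two neighbouring maxima can be
  moved across the adjacent leg of the other one.
\<close>

lemma caps_pair_exchange:
  assumes "Suc m < n"
  shows "cross Weld (2 * m) (cross Weld (Suc (2 * m)) (caps n)) =
    cross Weld (Suc (Suc (2 * m))) (cross Weld (Suc (2 * m)) (caps n))"
proof -
  define k where "k = n - 2"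
  with assms have k: "n = Suc (Suc k)" by simp
  let ?i = "2 * m"
  define y where "y = caps k"
  have wy: "?i \<le> width y" using assms k by (simp add: y_def)
  have n: "caps n = cap ?i (cap ?i y)"
    using caps_pair[of m "Suc k"] caps_pair[of m k] assms k by (simp add: y_def)
  have n': "caps n = cap (Suc (Suc ?i)) (cap ?i y)"
    using caps_pair[of "Suc m" "Suc k"] caps_pair[of m k] assms k by (simp add: y_def)
  have "cross Weld (Suc ?i) (caps n) = cross Weld ?i (cap (Suc ?i) (cap ?i y))"
    unfolding n using wy through_cap[of ?i "cap ?i y" Weld] by simp
  then have "cross Weld ?i (cross Weld (Suc ?i) (caps n)) = cap (Suc ?i) (cap ?i y)"
    using wy by simp
  moreover have "cross Weld (Suc ?i) (caps n) = cross Weld (Suc (Suc ?i)) (cap (Suc ?i) (cap ?i y))"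
    unfolding n' using wy through_cap[of "Suc ?i" "cap ?i y" Weld] by simp
  then have "cross Weld (Suc (Suc ?i)) (cross Weld (Suc ?i) (caps n)) = cap (Suc ?i) (cap ?i y)"
    using wy by simp
  ultimately show ?thesis by simp
qed

text \<open>
  Exchanging the two legs of a maximum, or two neighbouring maxima, brings the upper end of the leftmost
  strand further to the left, until it stays at position 0 and only crossings of other strands remain.
\<close>

lemma caps_absorb_cycle:
  "j < 2 * n \<Longrightarrow> \<exists>js. set js \<subseteq> {1..} \<and> (\<forall>i\<in>set js. Suc i < 2 * n) \<and>
    weld_braid [0..<j] (caps n) = weld_braid js (caps n)"
proof (induction j rule: less_induct)
  case (less j)
  have "j = 0 \<or> (\<exists>m. j = Suc (2 * m)) \<or> (\<exists>m. j = Suc (Suc (2 * m)))" by presburger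
  then consider "j = 0" | m where "j = Suc (2 * m)" | m where "j = Suc (Suc (2 * m))" by blast
  then show ?case
  proof cases
    case 1
    then show ?thesis by (intro exI[of _ "[]"]) simp
  next
    case (2 m)
    obtain k where k: "n = Suc k" using less.prems by (cases n) auto
    have "caps n = cap (2 * m) (caps k)" using caps_pair[of m k] 2 k less.prems by simp
    then have "cross Weld (2 * m) (caps n) = caps n" using RI_cap[of "2 * m" "caps k"] 2 k less.prems by simp
    then show ?thesis using less.IH[of "2 * m"] 2 less.prems by simp
  next
    case (3 m)
    let ?c = "weld_braid [0..<2 * m]"
    have far: "?c (cross Weld i y) = cross Weld i (?c y)" if "2 * m < i" "Suc i < width y" for i y
      using that by (intro weld_braid_far_right) auto
    have m: "Suc (Suc (Suc (2 * m))) < 2 * n" using 3 less.prems by presburger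
    have "?c (cross Weld (2 * m) (cross Weld (Suc (2 * m)) (caps n))) =
        ?c (cross Weld (Suc (Suc (2 * m))) (cross Weld (Suc (2 * m)) (caps n)))"
      using caps_pair_exchange[of m n] 3 less.prems by simp
    also have "\<dots> = cross Weld (Suc (Suc (2 * m))) (cross Weld (Suc (2 * m)) (?c (caps n)))"
      using m by (simp add: far)
    moreover obtain js where "set js \<subseteq> {1..}" "\<forall>i\<in>set js. Suc i < 2 * n" "?c (caps n) = weld_braid js (caps n)"
      using less.IH[of "2 * m"] 3 less.prems by auto
    ultimately show ?thesis using 3 m
      by (intro exI[of _ "Suc (Suc (2 * m)) # Suc (2 * m) # js"]) simp
  qed
qed

lemma weld_braid_caps:
  assumes "\<forall>i\<in>set is. Suc i < 2 * n" "0 < n"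
  shows "\<exists>js. set js \<subseteq> {1..} \<and> (\<forall>i\<in>set js. Suc i < 2 * n) \<and>
    weld_braid is (caps n) = weld_braid js (caps n)"
proof -
  obtain js j where js: "set js \<subseteq> {Suc 0..}" "\<forall>i\<in>set js. Suc i < 2 * n" "j < 2 * n"
    "weld_braid is (caps n) = weld_braid js (weld_braid [0..<j] (caps n))"
    using weld_normal_form[of "is" 0 "caps n"] assms by auto
  obtain ls where "set ls \<subseteq> {1..}" "\<forall>i\<in>set ls. Suc i < 2 * n"
    "weld_braid [0..<j] (caps n) = weld_braid ls (caps n)"
    using caps_absorb_cycle[OF js(3)] by blast
  then show ?thesis using js by (intro exI[of _ "js @ ls"]) auto
qed

abbreviation raise2 :: "nat list \<Rightarrow> nat list" where
  "raise2 \<equiv> map (\<lambda>i. Suc (Suc i))"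

lemma welds_raise2: "welds (raise2 is) = shift 2 (welds is)"
  by (simp add: welds_def shift_def)

lemma raise2_upt: "raise2 [0..<k] = [Suc (Suc 0)..<Suc (Suc k)]"
  by (induction k) auto

lemma weld_braid_cap:
  "\<forall>i\<in>set is. Suc i < width z \<Longrightarrow> weld_braid (raise2 is) (cap 0 z) = cap 0 (weld_braid is z)"
  by (simp add: welds_raise2 cap_braid fits_welds)

lemma weld_braid_cup:
  "\<forall>i\<in>set is. Suc i < n \<Longrightarrow> width z = Suc (Suc n) \<Longrightarrow>
    cup 0 (weld_braid (raise2 is) z) = weld_braid is (cup 0 z)"
  using braid_cups[of n "welds is" 1 z] by (simp add: welds_raise2 fits_welds cups_Suc)

lemma colorings_cups_scale:
  assumes "\<And>f. colorings z f = k * colorings z' f" "width z = width z'" "2 * n \<le> width z"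
  shows "colorings (cups n z) f = k * colorings (cups n z') f"
  using assms(3)
proof (induction n arbitrary: f)
  case (Suc n)
  then show ?case using assms(2) by (simp add: cups_Suc colorings_cup algebra_simps)
qed (simp add: assms(1))

text \<open>
  By \<open>weld_braid_caps\<close> the leftmost strand goes straight from the first minimum to the first maximum,
  and the normal form is applied to the strand next to it, the other leg of the first minimum. If this
  strand ends at position 1, it closes up to a separate circle with the leftmost strand, which doubles
  the number of colorings. Otherwise all crossings except one can be moved to strands on the right;
  the minimum, this crossing and the maximum form a zigzag with a kink.
\<close>

lemma weld_plat_trivial:
  assumes "rigid (cups n (weld_braid is (caps n)))" "\<forall>i\<in>set is. Suc i < 2 * n" "0 < n"
  shows "cups n (weld_braid is (caps n)) = cups 1 (caps 1)"
  using assms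
proof (induction n arbitrary: "is")
  case (Suc n)
  obtain js where js: "set js \<subseteq> {1..}" "\<forall>i\<in>set js. Suc i < 2 * Suc n"
    "weld_braid is (caps (Suc n)) = weld_braid js (caps (Suc n))"
    using weld_braid_caps[of "is" "Suc n"] Suc.prems by auto
  obtain ks j where ks: "set ks \<subseteq> {2..}" "\<forall>i\<in>set ks. Suc i < 2 * n + 2" "1 \<le> j" "j < 2 * n + 2"
    "weld_braid js (caps (Suc n)) = weld_braid ks (weld_braid [1..<j] (caps (Suc n)))"
    using weld_normal_form[of js 1 "caps (Suc n)"] js by (auto simp: numeral_2_eq_2)
  define ls where "ls = map (\<lambda>i. i - 2) ks"
  have "map (\<lambda>i. Suc (Suc (i - 2))) ks = ks"
    using ks(1) by (intro map_idI) (auto intro!: Suc_Suc_diff2)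
  then have ls: "ks = raise2 ls" by (simp add: ls_def o_def)
  have ls_less: "\<forall>i\<in>set ls. Suc i < 2 * n" using ks(2) ls by auto
  have D: "cups (Suc n) (weld_braid is (caps (Suc n))) =
      cups n (weld_braid ls (cup 0 (weld_braid [1..<j] (caps (Suc n)))))"
    using js(3) ks(5) ls_less by (simp add: cups_Suc' ls weld_braid_cup[of _ "2 * n"])
  show ?case
  proof (cases "n = 0")
    case True
    then have "js = []" using js by (cases js) auto
    then show ?thesis using js True by simp
  next
    case n: False
    show ?thesis
    proof (cases "j = 1")
      case True
      \<comment> \<open>a separate circle contradicts rigidity\<close>
      have "cups (Suc n) (weld_braid is (caps (Suc n))) =
          cups n (cup 0 (cap 0 (weld_braid ls (caps n))))"
        using js(3) ks(5) ls_less True by (simp add: cups_Suc' ls caps_Suc weld_braid_cap)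
      moreover have "colorings (cup 0 (cap 0 z)) f = 2 * colorings z f" for z f
      proof -
        have "drop_pair 0 (add_pair 0 b f) = f" for b by (auto simp: fun_eq_iff drop_pair_def add_pair_def)
        moreover have "add_pair 0 b f 0 = add_pair 0 b f (Suc 0)" for b by (simp add: add_pair_def)
        ultimately show ?thesis by (simp add: colorings_cup colorings_cap)
      qed
      ultimately have "colorings (cups (Suc n) (weld_braid is (caps (Suc n)))) (\<lambda>_. False) =
          2 * colorings (cups n (weld_braid ls (caps n))) (\<lambda>_. False)"
        using colorings_cups_scale[of "cup 0 (cap 0 (weld_braid ls (caps n)))" 2 "weld_braid ls (caps n)" n]
        by simp
      moreover have "2 \<le> colorings (cups n (weld_braid ls (caps n))) (\<lambda>_. False)"
        using ls_less n by (intro colorings_plat_ge_2) (auto simp: fits_welds)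
      ultimately show ?thesis using Suc.prems by (simp add: rigid_def)
    next
      case False
      \<comment> \<open>only the first crossing of the cycle \<open>1, ..., j - 1\<close> meets the first maximum\<close>
      define k where "k = j - 2"
      then have k: "j = Suc (Suc k)" using False ks by simp
      have "k < 2 * n" using ks k by simp
      then obtain ms where ms: "set ms \<subseteq> {1..}" "\<forall>i\<in>set ms. Suc i < 2 * n"
        "weld_braid [0..<k] (caps n) = weld_braid ms (caps n)"
        using caps_absorb_cycle by blast
      have "[1..<j] = 1 # raise2 [0..<k]"
        by (simp add: k raise2_upt upt_conv_Cons del: upt_Suc)
      then have "weld_braid [1..<j] (caps (Suc n)) = cross Weld 1 (weld_braid (raise2 [0..<k]) (cap 0 (caps n)))"
        by (simp add: caps_Suc)
      also have "\<dots> = cross Weld 1 (weld_braid (raise2 ms) (cap 0 (caps n)))"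
        using \<open>k < 2 * n\<close> ms by (simp add: weld_braid_cap)
      also have "\<dots> = weld_braid (raise2 ms) (cross Weld 1 (cap 0 (caps n)))"
        using ms by (subst weld_braid_far_left) auto
      finally have "cup 0 (weld_braid [1..<j] (caps (Suc n))) =
          weld_braid ms (cup 0 (cross Weld 1 (cap 0 (caps n))))"
        using ms by (simp add: weld_braid_cup[of _ "2 * n"])
      also have "cup 0 (cross Weld 1 (cap 0 (caps n))) = caps n"
        using n through_cup[of 0 "cap 0 (caps n)" Weld] zigzag_right[of 0 "caps n"]
        by (simp add: RI_cap)
      finally have "cups (Suc n) (weld_braid is (caps (Suc n))) = cups n (weld_braid (ls @ ms) (caps n))"
        using D by simp
      then show ?thesis using Suc.IH[of "ls @ ms"] Suc.prems ls_less ms n by auto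
    qed
  qed
qed simp

lemma trivial_diagram_abs: "abs_upper trivial_diagram = cups 1 (caps 1)"
proof -
  have "cups 1 (caps 1) = cup 0 (cap 0 (abs_upper []))"
    by (simp add: cups_Suc caps_Suc void_def)
  then show ?thesis by (simp add: put_abs trivial_diagram_def)
qed

text \<open>
  A nonempty closed diagram starts with a minimum. Setting this slice aside before passing to plat form
  ensures that the plat has at least one minimum.
\<close>

lemma knot_diagram_class:
  assumes "welded_knot_diagram D"
  shows "valid D" "word_width D = 0" "abs_upper D = cups 1 (caps 1)"
proof -
  have D: "tangle 0 D 0" "one_circle D"
    using assms by (simp_all add: welded_knot_diagram_def closed_diagram_def)
  then show v: "valid D" "word_width D = 0" using tangle_word_width[OF D(1)] by (simp_all add: valid_def)
  have rigid: "rigid (abs_upper D)"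
    using num_colorings_one_circle[OF D(2)] v by (simp add: rigid_def colorings_abs)
  have "D \<noteq> []" using D(2) by (auto simp: one_circle_def)
  then obtain e i w where w: "D = (e, i) # w" by (metis list.exhaust prod.exhaust)
  have "e = Cup" "i = 0" using D(1) w by (cases e; simp)+
  with v w have vw: "valid w" "word_width w = 2" by auto
  have cupw: "abs_upper D = cup 0 (abs_upper w)"
    using vw w \<open>e = Cup\<close> \<open>i = 0\<close> by (simp add: put_abs)
  obtain a b bs where ab: "width (abs_upper w) + 2 * a = 2 * b" "fits (2 * b) bs"
    "abs_upper w = cups a (braid bs (caps b))"
    using plat_form by blast
  have b: "b = Suc a" using ab(1) vw by (simp add: width_abs)
  have plat: "abs_upper D = cups b (braid bs (caps b))"
    using cupw ab(3) b by (simp add: cups_Suc)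
  have "abs_upper D = cups b (braid (welds (map snd bs)) (caps b))"
    using weld_all_crossings[of b bs] rigid ab(2) plat by simp
  moreover have "\<forall>i\<in>set (map snd bs). Suc i < 2 * b" using ab(2) by (auto simp: fits_def)
  ultimately show "abs_upper D = cups 1 (caps 1)"
    using weld_plat_trivial[of b "map snd bs"] rigid b by simp
qed

lemma move_step_closed:
  assumes "move_step w w'" "word_width w = 0"
  shows "twist_step w w' \<or> welded_step w w'"
proof -
  obtain u v l r where *: "any_move l r \<or> any_move r l" "w = u @ l @ v" "w' = u @ r @ v"
    and valid: "valid w" "valid w'" "word_width w' = 0"
    using assms unfolding move_step_def by auto
  then have closed: "closed_diagram w" "closed_diagram w'"
    using assms(2) by (simp_all add: valid_def closed_diagram_def)
  have "apply_move R w w'" if "R l r \<or> R r l" for R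
    unfolding apply_move_def using *(2,3) closed that by (intro conjI exI[of _ u] exI[of _ v] exI[of _ l] exI[of _ r])
  then have "apply_move isotopy_move w w' \<or> apply_move welded_reidemeister_move w w' \<or>
      apply_move twist_move w w'"
    using *(1) unfolding any_move_def by metis
  then show ?thesis unfolding twist_step_def welded_step_def by blast
qed

theorem theorem3p1:
  fixes D :: "slice list"
  assumes "welded_knot_diagram D"
  shows "(\<lambda>A B. twist_step A B \<or> welded_step A B)\<^sup>*\<^sup>* D trivial_diagram"
proof -
  let ?R = "\<lambda>A B. twist_step A B \<or> welded_step A B"
  note D = knot_diagram_class[OF assms]
  have "valid trivial_diagram" by (simp add: trivial_diagram_def)
  then have "move_equiv D trivial_diagram"
    using D Quotient_rel[OF Quotient_upper, of D trivial_diagram]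
    by (simp add: trivial_diagram_abs move_equiv_refl)
  then have "move_step\<^sup>*\<^sup>* D trivial_diagram" by (simp add: move_equiv_def)
  then have "?R\<^sup>*\<^sup>* D trivial_diagram \<and> word_width trivial_diagram = 0"
  proof induction
    case base
    then show ?case using D by simp
  next
    case (step y z)
    then have "?R y z" "word_width z = 0"
      using move_step_closed[of y z] by (simp_all add: move_step_def)
    with step.IH show ?case using rtranclp.rtrancl_into_rtrancl[of ?R D y z] by blast
  qed
  then show ?thesis ..
qed

end
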